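(* Assume the model is time homogeneous, $(E_n,G_n,H_n,M_n,\lambda_n)=(E,G,H,M,\lambda)$, and that for some $m\ge1$ and some $(\delta,\rho)\in[1,\infty)^2$ $$\forall (x,x')\in E^2:\quad G(x)\le\delta\,G(x')\quad\text{and}\quad M^m(x,dy)\le\rho\,M^m(x',dy).$$ Assume further that $\inf_{x,y,y'\in E}\big(H(x,y)/H(x,y')\big)>0$. Let $f_p\in\mathrm{Osc}_1(E)$, $p\ge0$, and $\overline F_n(x_0,\dots,x_n)=\frac1{n+1}\sum_{0\le p\le n}f_p(x_p)$. Then there is a finite constant $b<\infty$ (not depending on $n$, $N$, $\epsilon$) such that for any $\epsilon>0$ and $N\ge1$, $$\frac1N\log\sup_{n\ge0}\mathbb P\Big(\big|[\mathbb Q_n^N-\mathbb Q_n](\overline F_n)\big|\ge\frac b{\sqrt N}+\epsilon\Big)\le-\frac{\epsilon^2}{2b^2}.$$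
   Context: General notation. $\mathcal P(E)$: probability measures on $E$; $\mu(f)=\int f\,d\mu$; $M^m$ is the $m$-th iterate of the Markov transition $M$. $\mathrm{osc}(f)=\sup_{x,y}|f(x)-f(y)|$; $\mathrm{Osc}_1(E)$: measurable $f$ on $E$ with $\mathrm{osc}(f)\le1$. Feynman-Kac model (time homogeneous). $E$ is a measurable space, $(X_n)_{n\ge0}$ is an $E$-valued Markov chain with initial law $\eta_0$ and Markov transition $M$; $G:E\to(0,1]$ is measurable; $M(x,dy)=H(x,y)\lambda(dy)$ for some ($\sigma$-finite) measure $\lambda$ and measurable $H>0$. $\mathbb Q_n$ is the probability on $E^{n+1}$ with $\mathbb Q_n(F_n)\propto\mathbb E\big(F_n(X_0,\dots,X_n)\prod_{0\le p<n}G(X_p)\big)$. For $\eta\in\mathcal P(E)$, $\Phi(\eta)=\Psi_G(\eta)M$ with $\Psi_G(\eta)(dx)=G(x)\eta(dx)/\eta(G)$. Backward transitions. For $\eta\in\mathcal P(E)$, $\overleftarrow M_{\eta}(x,dy)=\dfrac{G(y)H(y,x)\,\eta(dy)}{\eta(GH(\cdot,x))}$. Particle model. Fix constants $\epsilon_n\ge0$ with $\epsilon_nG\le1$ (unrelated to $\epsilon$ in the claim), and let $K_{n+1,\eta}(x,dy)=\epsilon_nG(x)M(x,dy)+(1-\epsilon_nG(x))\,\Phi(\eta)(dy)$. The $N$-particle system $\xi_n=(\xi_n^1,\dots,\xi_n^N)\in E^N$ is the Markov chain with $\xi_0^i$ i.i.d. of law $\eta_0$ and, given $\xi_0,\dots,\xi_n$,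 the $\xi_{n+1}^i$ independent with $\xi_{n+1}^i\sim K_{n+1,\eta_n^N}(\xi_n^i,\cdot)$, where $\eta_n^N=\frac1N\sum_{j}\delta_{\xi_n^j}$. The particle approximation of $\mathbb Q_n$ is $\mathbb Q_n^N(d(x_0,\dots,x_n))=\eta_n^N(dx_n)\prod_{q=1}^n\overleftarrow M_{\eta_{q-1}^N}(x_q,dx_{q-1})$. *)

theory Defs
  imports "HOL-Probability.Probability"
begin

text \<open>Kernels on a measurable space \<open>E\<close> are functions into measures with the \<open>\<sigma>\<close>-algebra of \<open>E\<close>.
  Only the \<open>\<sigma>\<close>-algebra of the argument \<open>E\<close> matters below, not its measure.\<close>

fun kernel_pow :: "'a measure \<Rightarrow> ('a \<Rightarrow> 'a measure) \<Rightarrow> nat \<Rightarrow> 'a \<Rightarrow> 'a measure" where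
  "kernel_pow E M 0 x = return E x"
| "kernel_pow E M (Suc m) x = M x \<bind> kernel_pow E M m"

text \<open>The oscillation is extended-real valued because the real supremum of an unbounded set
  is unspecified.\<close>

definition osc :: "'a measure \<Rightarrow> ('a \<Rightarrow> real) \<Rightarrow> ereal" where
  "osc E f = (SUP (x, y) \<in> space E \<times> space E. ereal \<bar>f x - f y\<bar>)"

definition Osc1 :: "'a measure \<Rightarrow> ('a \<Rightarrow> real) set" where
  "Osc1 E = {f \<in> borel_measurable E. osc E f \<le> 1}"

text \<open>The logarithm with \<open>log 0 = -\<infinity>\<close>, unlike \<^const>\<open>ln\<close>.\<close>

definition eln :: "real \<Rightarrow> ereal" where
  "eln x = (if x \<le> 0 then -\<infinity> else ereal (ln x))"

definition boltzmann :: "('a \<Rightarrow> real) \<Rightarrow> 'a measure \<Rightarrow> 'a measure" where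
  "boltzmann g \<mu> = density \<mu> (\<lambda>x. ennreal (g x / (\<integral>y. g y \<partial>\<mu>)))"

definition mixture :: "real \<Rightarrow> 'a measure \<Rightarrow> 'a measure \<Rightarrow> 'a measure" where
  "mixture p \<mu> \<nu> = measure_of (space \<mu>) (sets \<mu>)
     (\<lambda>A. ennreal p * emeasure \<mu> A + ennreal (1 - p) * emeasure \<nu> A)"

text \<open>The law of \<open>(X\<^sub>0, \<dots>, X\<^sub>n)\<close> for a Markov chain on \<open>S\<close> with initial law \<open>\<mu>\<close>
  and transition \<open>K k\<close> from time \<open>k\<close> to time \<open>k + 1\<close>.\<close>

fun markov_path ::
  "'s measure \<Rightarrow> 's measure \<Rightarrow> (nat \<Rightarrow> 's \<Rightarrow> 's measure) \<Rightarrow> nat \<Rightarrow> (nat \<Rightarrow> 's) measure" where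
  "markov_path S \<mu> K 0 = distr \<mu> (Pi\<^sub>M {..0} (\<lambda>_. S)) (\<lambda>x. \<lambda>i\<in>{..0}. x)"
| "markov_path S \<mu> K (Suc n) = markov_path S \<mu> K n \<bind>
     (\<lambda>w. distr (K n (w n)) (Pi\<^sub>M {..Suc n} (\<lambda>_. S)) (\<lambda>x. w(Suc n := x)))"

locale feynman_kac_model =
  fixes E :: "'a measure" and \<eta>0 :: "'a measure" and M :: "'a \<Rightarrow> 'a measure"
    and G :: "'a \<Rightarrow> real" and H :: "'a \<Rightarrow> 'a \<Rightarrow> real" and lam :: "'a measure"
  assumes initial: "prob_space \<eta>0" "sets \<eta>0 = sets E"
    and transition: "M \<in> E \<rightarrow>\<^sub>M prob_algebra E"
    and potential_measurable: "G \<in> borel_measurable E"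
    and potential_range: "\<And>x. x \<in> space E \<Longrightarrow> 0 < G x \<and> G x \<le> 1"
    and reference: "sigma_finite_measure lam" "sets lam = sets E"
    and density_measurable: "(\<lambda>(x, y). H x y) \<in> borel_measurable (E \<Otimes>\<^sub>M E)"
    and density_pos: "\<And>x y. x \<in> space E \<Longrightarrow> y \<in> space E \<Longrightarrow> 0 < H x y"
    and transition_density: "\<And>x. x \<in> space E \<Longrightarrow> M x = density lam (\<lambda>y. ennreal (H x y))"

definition FK_path ::
  "'a measure \<Rightarrow> 'a measure \<Rightarrow> ('a \<Rightarrow> 'a measure) \<Rightarrow> ('a \<Rightarrow> real) \<Rightarrow> nat \<Rightarrow> (nat \<Rightarrow> 'a) measure" where
  "FK_path E \<eta>0 M G n =
     boltzmann (\<lambda>x. \<Prod>p<n. G (x p)) (markov_path E \<eta>0 (\<lambda>_. M) n)"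

definition FK_map :: "('a \<Rightarrow> 'a measure) \<Rightarrow> ('a \<Rightarrow> real) \<Rightarrow> 'a measure \<Rightarrow> 'a measure" where
  "FK_map M G \<eta> = boltzmann G \<eta> \<bind> M"

definition backward_kernel ::
  "('a \<Rightarrow> real) \<Rightarrow> ('a \<Rightarrow> 'a \<Rightarrow> real) \<Rightarrow> 'a measure \<Rightarrow> 'a \<Rightarrow> 'a measure" where
  "backward_kernel G H \<eta> x = boltzmann (\<lambda>y. G y * H y x) \<eta>"

text \<open>Particles are indexed by \<open>{..<N}\<close>; a configuration is an element of the product space
  \<open>E\<^sup>N\<close> below.\<close>

definition empirical :: "'a measure \<Rightarrow> nat \<Rightarrow> (nat \<Rightarrow> 'a) \<Rightarrow> 'a measure" where
  "empirical E N x = distr (uniform_count_measure {..<N}) E x"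

definition particle_space :: "'a measure \<Rightarrow> nat \<Rightarrow> (nat \<Rightarrow> 'a) measure" where
  "particle_space E N = Pi\<^sub>M {..<N} (\<lambda>_. E)"

text \<open>\<open>mckean_kernel M G eps n \<eta>\<close> is \<open>K\<^bsub>n+1,\<eta>\<^esub>\<close>, the transition from time \<open>n\<close> to time \<open>n + 1\<close>.\<close>

definition mckean_kernel ::
  "('a \<Rightarrow> 'a measure) \<Rightarrow> ('a \<Rightarrow> real) \<Rightarrow> (nat \<Rightarrow> real) \<Rightarrow> nat \<Rightarrow> 'a measure \<Rightarrow> 'a \<Rightarrow> 'a measure" where
  "mckean_kernel M G eps n \<eta> x = mixture (eps n * G x) (M x) (FK_map M G \<eta>)"

definition particle_kernel ::
  "'a measure \<Rightarrow> ('a \<Rightarrow> 'a measure) \<Rightarrow> ('a \<Rightarrow> real) \<Rightarrow> (nat \<Rightarrow> real) \<Rightarrow> nat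
    \<Rightarrow> nat \<Rightarrow> (nat \<Rightarrow> 'a) \<Rightarrow> (nat \<Rightarrow> 'a) measure" where
  "particle_kernel E M G eps N n x =
     Pi\<^sub>M {..<N} (\<lambda>i. mckean_kernel M G eps n (empirical E N x) (x i))"

text \<open>The law of \<open>(\<xi>\<^sub>0, \<dots>, \<xi>\<^sub>n)\<close>; particle \<open>i\<close> at time \<open>p\<close> is \<open>\<xi> p i\<close>.\<close>

definition particle_law ::
  "'a measure \<Rightarrow> 'a measure \<Rightarrow> ('a \<Rightarrow> 'a measure) \<Rightarrow> ('a \<Rightarrow> real) \<Rightarrow> (nat \<Rightarrow> real) \<Rightarrow> nat
    \<Rightarrow> nat \<Rightarrow> (nat \<Rightarrow> nat \<Rightarrow> 'a) measure" where
  "particle_law E \<eta>0 M G eps N n =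
     markov_path (particle_space E N) (Pi\<^sub>M {..<N} (\<lambda>_. \<eta>0)) (particle_kernel E M G eps N) n"

text \<open>For \<open>\<eta>\<^sub>0, \<dots>, \<eta>\<^sub>n\<close>, the measure
  \<open>\<eta>\<^sub>n(dx\<^sub>n) \<Prod>\<^sub>q\<^sub>=\<^sub>1\<^sub>.\<^sub>.\<^sub>n M\<^bsub>\<eta>(q-1)\<^esub>(x\<^sub>q, dx\<^sub>q\<^sub>-\<^sub>1)\<close> with backward kernels \<open>M\<close>:
  the chain started from \<open>\<eta>\<^sub>n\<close> at time \<open>n\<close> is run backwards, its step \<open>k\<close> leading from time
  \<open>n - k\<close> to time \<open>n - k - 1\<close>, and the resulting path is then reversed.\<close>

definition backward_path ::
  "'a measure \<Rightarrow> ('a \<Rightarrow> real) \<Rightarrow> ('a \<Rightarrow> 'a \<Rightarrow> real) \<Rightarrow> (nat \<Rightarrow> 'a measure) \<Rightarrow> nat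
    \<Rightarrow> (nat \<Rightarrow> 'a) measure" where
  "backward_path E G H \<eta> n =
     distr (markov_path E (\<eta> n) (\<lambda>k. backward_kernel G H (\<eta> (n - k - 1))) n)
       (Pi\<^sub>M {..n} (\<lambda>_. E)) (\<lambda>w. \<lambda>p\<in>{..n}. w (n - p))"

definition FK_path_approx ::
  "'a measure \<Rightarrow> ('a \<Rightarrow> real) \<Rightarrow> ('a \<Rightarrow> 'a \<Rightarrow> real) \<Rightarrow> nat \<Rightarrow> nat \<Rightarrow> (nat \<Rightarrow> nat \<Rightarrow> 'a)
    \<Rightarrow> (nat \<Rightarrow> 'a) measure" where
  "FK_path_approx E G H N n \<xi> = backward_path E G H (\<lambda>p. empirical E N (\<xi> p)) n"

definition additive_mean :: "(nat \<Rightarrow> 'a \<Rightarrow> real) \<Rightarrow> nat \<Rightarrow> (nat \<Rightarrow> 'a) \<Rightarrow> real" where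
  "additive_mean f n x = (1 / real (n + 1)) * (\<Sum>p\<le>n. f p (x p))"

end

theory Submission
  imports Defs
begin

text \<open>Comparability of \<open>H\<close> in its second argument makes both \<open>M\<close> and all backward kernels
  contractions with a rate \<open>r < 1\<close>. Fix a time \<open>p \<le> n\<close> and a function of the state at time \<open>p\<close>.
  Let \<open>C\<^sub>k\<close> be the mean, under the empirical measure at time \<open>k\<close> weighted with the potentials
  still to come up to time \<open>n\<close>, of the smoothed function \<open>u\<^sub>k\<close>: for \<open>k \<le> p\<close> smoothing uses the
  exact chain, for \<open>k \<ge> p\<close> the empirical backward kernels. Then \<open>C\<^sub>n\<close> is the particle
  approximation, and duality of forward and backward transitions shows that \<open>C\<^sub>k - C\<^sub>k\<^sub>-\<^sub>1\<close> is a ratio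
  whose numerator is an average of \<open>N\<close> terms that are conditionally independent given the past and
  have conditional means summing to zero, each bounded by a multiple of \<open>r\<close> to the power \<open>\<bar>k - p\<bar>\<close>.
  By Hoeffding's lemma the increments are sub-Gaussian at scale \<open>1 / sqrt N\<close>, with a geometric
  series of constants. Sub-Gaussianity survives sums and averages without independence, and the
  slack \<open>b / sqrt N\<close> absorbs the prefactor of the tail bound.\<close>

section \<open>Bounded measurable functions and kernels\<close>

text \<open>The backward kernels are built from random empirical measures, so no property of those
  measures may enter the rate. In the weight \<open>G z * H z y\<close> the variable
  \<open>y\<close> occurs only in \<open>H\<close>, hence changing \<open>y\<close> costs at most a
  factor \<theta>, whatever the particles are. That factor is lost twice, in the numerator and in
  the normalising denominator, whence \<open>r = 1 - \<theta>\<^sup>2\<close>. The increments have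
  random denominators. As every \<open>W j\<close> varies by at most the factor \<kappa>, the
  denominator may be replaced by a deterministic lower bound, at the price of
  \<open>\<kappa>\<^sup>2\<close> in the scale. The contribution of a single particle need not be
  centred: with probability \<open>eps n * G x\<close> a particle moves from its own position by
  \<open>M\<close>. These deviations cancel only in the sum over all particles, which is why the
  Hoeffding bound below asks for a vanishing sum of means. The constants depend on \<theta> and
  \<delta> alone. Summing powers of \<open>r\<close> on both sides of \<open>p\<close> gives a bound
  free of \<open>n\<close> and \<open>p\<close>, as the supremum over \<open>n\<close>
  requires.\<close>

definition bounded_measurable :: "'a measure \<Rightarrow> ('a \<Rightarrow> real) set" where
  "bounded_measurable M = {f \<in> borel_measurable M. \<exists>B. \<forall>x\<in>space M. \<bar>f x\<bar> \<le> B}"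

lemma bounded_measurableI:
  "f \<in> borel_measurable M \<Longrightarrow> (\<And>x. x \<in> space M \<Longrightarrow> \<bar>f x\<bar> \<le> B) \<Longrightarrow> f \<in> bounded_measurable M"
  unfolding bounded_measurable_def by blast

lemma bounded_measurable_measurable: "f \<in> bounded_measurable M \<Longrightarrow> f \<in> borel_measurable M"
  unfolding bounded_measurable_def by blast

lemma bounded_measurableE:
  assumes "f \<in> bounded_measurable M"
  obtains B where "0 \<le> B" "\<And>x. x \<in> space M \<Longrightarrow> \<bar>f x\<bar> \<le> B"
proof -
  obtain B where "\<forall>x\<in>space M. \<bar>f x\<bar> \<le> B" using assms unfolding bounded_measurable_def by blast
  then show ?thesis by (intro that[of "max 0 B"]) (auto simp: le_max_iff_disj)
qed

lemma bounded_measurable_const [simp]: "(\<lambda>_. c) \<in> bounded_measurable M"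
  by (rule bounded_measurableI[where B = "\<bar>c\<bar>"]) auto

lemma bounded_measurable_add:
  assumes f: "f \<in> bounded_measurable M" and g: "g \<in> bounded_measurable M"
  shows "(\<lambda>x. f x + g x) \<in> bounded_measurable M"
proof -
  note [measurable] = bounded_measurable_measurable[OF f] bounded_measurable_measurable[OF g]
  obtain B where B: "\<And>x. x \<in> space M \<Longrightarrow> \<bar>f x\<bar> \<le> B" using f by (meson bounded_measurableE)
  obtain C where C: "\<And>x. x \<in> space M \<Longrightarrow> \<bar>g x\<bar> \<le> C" using g by (meson bounded_measurableE)
  show ?thesis
  proof (rule bounded_measurableI)
    show "\<bar>f x + g x\<bar> \<le> B + C" if "x \<in> space M" for x
      using abs_triangle_ineq[of "f x" "g x"] B[OF that] C[OF that] by linarith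
  qed measurable
qed

lemma bounded_measurable_mult:
  assumes f: "f \<in> bounded_measurable M" and g: "g \<in> bounded_measurable M"
  shows "(\<lambda>x. f x * g x) \<in> bounded_measurable M"
proof -
  note [measurable] = bounded_measurable_measurable[OF f] bounded_measurable_measurable[OF g]
  obtain B where B: "0 \<le> B" "\<And>x. x \<in> space M \<Longrightarrow> \<bar>f x\<bar> \<le> B" using f by (meson bounded_measurableE)
  obtain C where C: "\<And>x. x \<in> space M \<Longrightarrow> \<bar>g x\<bar> \<le> C" using g by (meson bounded_measurableE)
  show ?thesis
  proof (rule bounded_measurableI)
    show "\<bar>f x * g x\<bar> \<le> B * C" if "x \<in> space M" for x
      unfolding abs_mult by (intro mult_mono B C that) simp_all
  qed measurable
qed

lemma bounded_measurable_diff: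
  assumes "f \<in> bounded_measurable M" "g \<in> bounded_measurable M"
  shows "(\<lambda>x. f x - g x) \<in> bounded_measurable M"
  using bounded_measurable_add[OF assms(1) bounded_measurable_mult[OF bounded_measurable_const[of "-1"] assms(2)]]
  by simp

lemma bounded_measurable_sum:
  "(\<And>i. i \<in> I \<Longrightarrow> f i \<in> bounded_measurable M) \<Longrightarrow> (\<lambda>x. \<Sum>i\<in>I. f i x) \<in> bounded_measurable M"
  by (induction I rule: infinite_finite_induct) (auto intro: bounded_measurable_add)

lemma bounded_measurable_prod:
  "(\<And>i. i \<in> I \<Longrightarrow> f i \<in> bounded_measurable M) \<Longrightarrow> (\<lambda>x. \<Prod>i\<in>I. f i x) \<in> bounded_measurable M"
  by (induction I rule: infinite_finite_induct) (auto intro: bounded_measurable_mult)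

lemma bounded_measurable_comp:
  assumes f: "f \<in> bounded_measurable N" and g: "g \<in> M \<rightarrow>\<^sub>M N"
  shows "(\<lambda>x. f (g x)) \<in> bounded_measurable M"
proof -
  obtain B where "\<And>x. x \<in> space N \<Longrightarrow> \<bar>f x\<bar> \<le> B" using f by (meson bounded_measurableE)
  then show ?thesis
    using measurable_compose[OF g bounded_measurable_measurable[OF f]] measurable_space[OF g]
    by (intro bounded_measurableI[where B = B]) auto
qed

section \<open>Integration against probability measures and kernels\<close>

lemma prob_algebraD:
  assumes "\<mu> \<in> space (prob_algebra M)"
  shows "prob_space \<mu>" "sets \<mu> = sets M" "space \<mu> = space M"
  using assms by (auto simp: space_prob_algebra dest: sets_eq_imp_space_eq)

lemma prob_algebra_kernelD:
  assumes "K \<in> M \<rightarrow>\<^sub>M prob_algebra N" "x \<in> space M"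
  shows "prob_space (K x)" "sets (K x) = sets N" "space (K x) = space N"
  using prob_algebraD[OF measurable_space[OF assms]] .

lemma integrable_bounded_measurable:
  assumes \<mu>: "\<mu> \<in> space (prob_algebra M)" and f: "f \<in> bounded_measurable M"
  shows "integrable \<mu> f"
proof -
  interpret prob_space \<mu> using prob_algebraD[OF \<mu>] by simp
  obtain B where "\<And>x. x \<in> space M \<Longrightarrow> \<bar>f x\<bar> \<le> B" using f by (meson bounded_measurableE)
  then show ?thesis
    using bounded_measurable_measurable[OF f] prob_algebraD[OF \<mu>]
    by (intro integrable_const_bound[where B = B] AE_I2) (auto cong: measurable_cong_sets)
qed

lemma prob_integral_mono:
  assumes \<mu>: "\<mu> \<in> space (prob_algebra M)"
    and f: "f \<in> bounded_measurable M" and g: "g \<in> bounded_measurable M"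
    and le: "\<And>x. x \<in> space M \<Longrightarrow> f x \<le> g x"
  shows "(\<integral>x. f x \<partial>\<mu>) \<le> (\<integral>x. g x \<partial>\<mu>)"
  using le prob_algebraD[OF \<mu>]
  by (intro integral_mono integrable_bounded_measurable[OF \<mu>] f g) auto

lemma prob_integral_const:
  assumes \<mu>: "\<mu> \<in> space (prob_algebra M)"
  shows "(\<integral>x. c \<partial>\<mu>) = (c::real)"
  using prob_space.prob_space[OF prob_algebraD(1)[OF \<mu>]] by simp

lemma kernel_integral_bounded_measurable:
  assumes K: "K \<in> M \<rightarrow>\<^sub>M prob_algebra N" and f: "f \<in> bounded_measurable N"
  shows "(\<lambda>x. \<integral>y. f y \<partial>K x) \<in> bounded_measurable M"
proof -
  obtain B where B: "\<And>x. x \<in> space N \<Longrightarrow> \<bar>f x\<bar> \<le> B" using f by (meson bounded_measurableE)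
  show ?thesis
  proof (rule bounded_measurableI)
    show "(\<lambda>x. \<integral>y. f y \<partial>K x) \<in> borel_measurable M"
      using measurable_compose[OF measurable_prob_algebraD[OF K]
          integral_measurable_subprob_algebra[OF bounded_measurable_measurable[OF f]]] .
    fix x assume x: "x \<in> space M"
    note Kx = measurable_space[OF K x]
    have "(\<integral>y. f y \<partial>K x) \<le> (\<integral>y. B \<partial>K x)" "(\<integral>y. -B \<partial>K x) \<le> (\<integral>y. f y \<partial>K x)"
      using B by (intro prob_integral_mono[OF Kx] f bounded_measurable_const; force simp: abs_le_iff)+
    then show "\<bar>\<integral>y. f y \<partial>K x\<bar> \<le> B"
      unfolding prob_integral_const[OF Kx] by simp
  qed
qed

lemma integral_bind_bounded:
  assumes \<mu>: "\<mu> \<in> space (prob_algebra M)" and K: "K \<in> M \<rightarrow>\<^sub>M prob_algebra N"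
    and f: "f \<in> bounded_measurable N"
  shows "(\<integral>y. f y \<partial>(\<mu> \<bind> K)) = (\<integral>x. \<integral>y. f y \<partial>K x \<partial>\<mu>)"
proof -
  interpret prob_space \<mu> using prob_algebraD[OF \<mu>] by simp
  have K': "K \<in> \<mu> \<rightarrow>\<^sub>M prob_algebra N"
    using K prob_algebraD[OF \<mu>] by (simp cong: measurable_cong_sets)
  obtain B where B: "\<And>x. x \<in> space N \<Longrightarrow> \<bar>f x\<bar> \<le> B" using f by (meson bounded_measurableE)
  show ?thesis
    using prob_space.emeasure_space_1[OF prob_algebra_kernelD(1)[OF K']]
    by (intro integral_bind[OF bounded_measurable_measurable[OF f] B measurable_prob_algebraD[OF K'], where B' = 1])
      (auto intro: finite_measure_axioms)
qed

lemma bind_prob_algebra: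
  assumes \<mu>: "\<mu> \<in> space (prob_algebra M)" and K: "K \<in> M \<rightarrow>\<^sub>M prob_algebra N"
  shows "\<mu> \<bind> K \<in> space (prob_algebra N)"
  using prob_space_bind'[OF \<mu> K] sets_bind'[OF \<mu> K] by (simp add: space_prob_algebra)

section \<open>Markov path measures\<close>

locale markov_kernels =
  fixes S \<mu> :: "'s measure" and K :: "nat \<Rightarrow> 's \<Rightarrow> 's measure"
  assumes init: "\<mu> \<in> space (prob_algebra S)"
    and kernel: "\<And>k. K k \<in> S \<rightarrow>\<^sub>M prob_algebra S"
begin

abbreviation "path_law n \<equiv> markov_path S \<mu> K n"
abbreviation "paths n \<equiv> Pi\<^sub>M {..n} (\<lambda>_. S)"

lemma measurable_path_update: "(\<lambda>(w, x). w(Suc n := x)) \<in> paths n \<Otimes>\<^sub>M S \<rightarrow>\<^sub>M paths (Suc n)"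
  unfolding atMost_Suc by (rule measurable_add_dim)

lemma measurable_path_update1: "w \<in> space (paths n) \<Longrightarrow> (\<lambda>x. w(Suc n := x)) \<in> S \<rightarrow>\<^sub>M paths (Suc n)"
  using measurable_compose[OF measurable_Pair1' measurable_path_update] by auto

lemma measurable_path_coord: "k \<le> n \<Longrightarrow> (\<lambda>w. w k) \<in> paths n \<rightarrow>\<^sub>M S"
  by (rule measurable_component_singleton) simp

lemma step_kernel:
  "(\<lambda>w. distr (K n (w n)) (paths (Suc n)) (\<lambda>x. w(Suc n := x))) \<in> paths n \<rightarrow>\<^sub>M prob_algebra (paths (Suc n))"
  using measurable_compose[OF measurable_path_coord[OF order_refl] kernel, of n n] measurable_path_update[of n]
  by (rule measurable_distr_prob_space2)

lemma path_prob: "path_law n \<in> space (prob_algebra (paths n))"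
proof (induction n)
  case 0
  have "(\<lambda>x. \<lambda>i\<in>{..0}. x) \<in> S \<rightarrow>\<^sub>M paths 0" by measurable
  then show ?case
    unfolding markov_path.simps using measurable_space[OF measurable_distr_prob_space init] by blast
next
  case (Suc n)
  then show ?case using bind_prob_algebra[OF Suc step_kernel] by simp
qed

lemma path_coord_space: "w \<in> space (paths n) \<Longrightarrow> k \<le> n \<Longrightarrow> w k \<in> space S"
  using measurable_space[OF measurable_path_coord] .

lemma K_path: "w \<in> space (paths n) \<Longrightarrow> K n (w n) \<in> space (prob_algebra S)"
  using path_coord_space[of w n n] measurable_space[OF kernel] by auto

lemma nn_integral_path_Suc:
  assumes F: "F \<in> borel_measurable (paths (Suc n))"
  shows "(\<integral>\<^sup>+w. F w \<partial>path_law (Suc n)) = (\<integral>\<^sup>+w. \<integral>\<^sup>+x. F (w(Suc n := x)) \<partial>K n (w n) \<partial>path_law n)"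
proof -
  note P = prob_algebraD[OF path_prob[of n]]
  have m: "(\<lambda>w. distr (K n (w n)) (paths (Suc n)) (\<lambda>x. w(Suc n := x))) \<in> path_law n \<rightarrow>\<^sub>M subprob_algebra (paths (Suc n))"
    using measurable_prob_algebraD[OF step_kernel] P by (simp cong: measurable_cong_sets)
  show ?thesis
    unfolding markov_path.simps nn_integral_bind[OF F m]
  proof (rule nn_integral_cong)
    fix w assume "w \<in> space (path_law n)"
    then have w: "w \<in> space (paths n)" using P by simp
    have "(\<lambda>x. w(Suc n := x)) \<in> K n (w n) \<rightarrow>\<^sub>M paths (Suc n)"
      using measurable_path_update1[OF w] prob_algebraD[OF K_path[OF w]] by (simp cong: measurable_cong_sets)
    then show "(\<integral>\<^sup>+x. F x \<partial>distr (K n (w n)) (paths (Suc n)) (\<lambda>x. w(Suc n := x))) = (\<integral>\<^sup>+x. F (w(Suc n := x)) \<partial>K n (w n))"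
      using F by (intro nn_integral_distr) auto
  qed
qed

lemma integral_path_Suc:
  assumes F: "F \<in> bounded_measurable (paths (Suc n))"
  shows "(\<integral>w. F w \<partial>path_law (Suc n)) = (\<integral>w. \<integral>x. F (w(Suc n := x)) \<partial>K n (w n) \<partial>path_law n)"
  unfolding markov_path.simps integral_bind_bounded[OF path_prob step_kernel F]
proof (rule Bochner_Integration.integral_cong[OF refl])
  fix w assume "w \<in> space (path_law n)"
  then have w: "w \<in> space (paths n)" using prob_algebraD[OF path_prob[of n]] by simp
  have "(\<lambda>x. w(Suc n := x)) \<in> K n (w n) \<rightarrow>\<^sub>M paths (Suc n)"
    using measurable_path_update1[OF w] prob_algebraD[OF K_path[OF w]] by (simp cong: measurable_cong_sets)
  then show "(\<integral>x. F x \<partial>distr (K n (w n)) (paths (Suc n)) (\<lambda>x. w(Suc n := x))) = (\<integral>x. F (w(Suc n := x)) \<partial>K n (w n))"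
    using bounded_measurable_measurable[OF F] by (rule integral_distr)
qed

lemma integral_path_0:
  assumes F: "\<phi> \<in> bounded_measurable S"
  shows "(\<integral>w. \<phi> (w 0) \<partial>path_law 0) = (\<integral>x. \<phi> x \<partial>\<mu>)"
proof -
  note [measurable] = bounded_measurable_measurable[OF F]
  have "(\<lambda>x. \<lambda>i\<in>{..0}. x) \<in> S \<rightarrow>\<^sub>M paths 0" by measurable
  then have m: "(\<lambda>x. \<lambda>i\<in>{..0}. x) \<in> \<mu> \<rightarrow>\<^sub>M paths 0"
    using prob_algebraD[OF init] by (simp cong: measurable_cong_sets)
  show ?thesis
    unfolding markov_path.simps by (subst integral_distr[OF m]) auto
qed

text \<open>The Markov property in the form used later. \<open>F_update\<close> expresses that
  \<open>F\<close> does not read the newest state; boundedness is asked on two spaces because paths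
  of different lengths live in different product spaces.\<close>

lemma integral_path_product:
  assumes F: "F \<in> bounded_measurable (paths (Suc n))" "F \<in> bounded_measurable (paths n)"
    and F_update: "\<And>w x. F (w(Suc n := x)) = F w"
    and \<phi>: "\<phi> \<in> bounded_measurable S"
  shows "(\<integral>w. F w * \<phi> (w (Suc n)) \<partial>path_law (Suc n)) = (\<integral>w. F w * (\<integral>x. \<phi> x \<partial>K n (w n)) \<partial>path_law n)"
proof -
  have "(\<lambda>w. F w * \<phi> (w (Suc n))) \<in> bounded_measurable (paths (Suc n))"
    by (intro bounded_measurable_mult F bounded_measurable_comp[OF \<phi>] measurable_path_coord order_refl)
  from integral_path_Suc[OF this] show ?thesis by (simp add: F_update)
qed

end

section \<open>Sub-Gaussian random variables\<close>

text \<open>Using the absolute value makes the notion pass to every variable dominated by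
  \<open>X\<close>, which is how random denominators are removed. The factor 2 pays for bounding
  \<open>exp \<bar>z\<bar>\<close> by \<open>exp z + exp (- z)\<close>. The nonnegative integral
  spares integrability conditions.\<close>

definition subgaussian :: "'a measure \<Rightarrow> ('a \<Rightarrow> real) \<Rightarrow> real \<Rightarrow> bool" where
  "subgaussian P X \<sigma> \<longleftrightarrow> X \<in> borel_measurable P \<and>
     (\<forall>s\<ge>0. (\<integral>\<^sup>+\<omega>. ennreal (exp (s * \<bar>X \<omega>\<bar>)) \<partial>P) \<le> ennreal (2 * exp (s\<^sup>2 * \<sigma>\<^sup>2 / 2)))"

lemma subgaussian_measurable: "subgaussian P X \<sigma> \<Longrightarrow> X \<in> borel_measurable P"
  unfolding subgaussian_def by simp

lemma subgaussian_le:
  "subgaussian P X \<sigma> \<Longrightarrow> 0 \<le> s \<Longrightarrow>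
    (\<integral>\<^sup>+\<omega>. ennreal (exp (s * \<bar>X \<omega>\<bar>)) \<partial>P) \<le> ennreal (2 * exp (s\<^sup>2 * \<sigma>\<^sup>2 / 2))"
  unfolding subgaussian_def by simp

lemma subgaussian_mono:
  assumes X: "subgaussian P X \<sigma>" and Y: "Y \<in> borel_measurable P"
    and le: "\<And>\<omega>. \<omega> \<in> space P \<Longrightarrow> \<bar>Y \<omega>\<bar> \<le> \<bar>X \<omega>\<bar>" and \<sigma>: "0 \<le> \<sigma>" "\<sigma> \<le> \<sigma>'"
  shows "subgaussian P Y \<sigma>'"
  unfolding subgaussian_def
proof (intro conjI allI impI Y)
  fix s :: real assume s: "0 \<le> s"
  have "(\<integral>\<^sup>+\<omega>. ennreal (exp (s * \<bar>Y \<omega>\<bar>)) \<partial>P) \<le> (\<integral>\<^sup>+\<omega>. ennreal (exp (s * \<bar>X \<omega>\<bar>)) \<partial>P)"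
    by (intro nn_integral_mono) (use le s in \<open>auto intro!: mult_left_mono simp: ennreal_leI\<close>)
  also have "\<dots> \<le> ennreal (2 * exp (s\<^sup>2 * \<sigma>\<^sup>2 / 2))" using X s by (rule subgaussian_le)
  also have "\<dots> \<le> ennreal (2 * exp (s\<^sup>2 * \<sigma>'\<^sup>2 / 2))"
    using \<sigma> by (intro ennreal_leI mult_left_mono) (auto intro!: divide_right_mono mult_left_mono power_mono)
  finally show "(\<integral>\<^sup>+\<omega>. ennreal (exp (s * \<bar>Y \<omega>\<bar>)) \<partial>P) \<le> ennreal (2 * exp (s\<^sup>2 * \<sigma>'\<^sup>2 / 2))" .
qed

lemma subgaussian_scale:
  assumes X: "subgaussian P X \<sigma>" and c: "0 \<le> c"
  shows "subgaussian P (\<lambda>\<omega>. c * X \<omega>) (c * \<sigma>)"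
  unfolding subgaussian_def
proof (intro conjI allI impI)
  note [measurable] = subgaussian_measurable[OF X]
  show "(\<lambda>\<omega>. c * X \<omega>) \<in> borel_measurable P" by measurable
  fix s :: real assume s: "0 \<le> s"
  have "(\<integral>\<^sup>+\<omega>. ennreal (exp ((s * c) * \<bar>X \<omega>\<bar>)) \<partial>P) \<le> ennreal (2 * exp ((s * c)\<^sup>2 * \<sigma>\<^sup>2 / 2))"
    using s c by (intro subgaussian_le[OF X]) auto
  then show "(\<integral>\<^sup>+\<omega>. ennreal (exp (s * \<bar>c * X \<omega>\<bar>)) \<partial>P) \<le> ennreal (2 * exp (s\<^sup>2 * (c * \<sigma>)\<^sup>2 / 2))"
    using c by (simp add: abs_mult power_mult_distrib mult_ac)
qed

text \<open>No independence is needed: this is Jensen's inequality with weights proportional to \<open>\<sigma>\<close>.\<close>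

lemma subgaussian_sum:
  assumes I: "finite I" "I \<noteq> {}" and X: "\<And>i. i \<in> I \<Longrightarrow> subgaussian P (X i) (\<sigma> i)"
    and \<sigma>: "\<And>i. i \<in> I \<Longrightarrow> 0 < \<sigma> i"
  shows "subgaussian P (\<lambda>\<omega>. \<Sum>i\<in>I. X i \<omega>) (\<Sum>i\<in>I. \<sigma> i)"
  unfolding subgaussian_def
proof (intro conjI allI impI)
  note [measurable] = subgaussian_measurable[OF X]
  show "(\<lambda>\<omega>. \<Sum>i\<in>I. X i \<omega>) \<in> borel_measurable P" by measurable
  fix s :: real assume s: "0 \<le> s"
  define T where "T = (\<Sum>i\<in>I. \<sigma> i)"
  have T: "0 < T" unfolding T_def using I \<sigma> by (intro sum_pos) auto
  define w where "w i = \<sigma> i / T" for i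
  have w: "0 < w i" if "i \<in> I" for i using \<sigma>[OF that] T by (simp add: w_def)
  have w1: "(\<Sum>i\<in>I. w i) = 1" using T unfolding w_def by (simp flip: sum_divide_distrib T_def)
  have jensen: "exp (s * \<bar>\<Sum>i\<in>I. X i \<omega>\<bar>) \<le> (\<Sum>i\<in>I. w i * exp ((s / w i) * \<bar>X i \<omega>\<bar>))" for \<omega>
  proof -
    have "s * \<bar>\<Sum>i\<in>I. X i \<omega>\<bar> \<le> s * (\<Sum>i\<in>I. \<bar>X i \<omega>\<bar>)" using s by (intro mult_left_mono sum_abs)
    also have "\<dots> = (\<Sum>i\<in>I. w i *\<^sub>R ((s / w i) * \<bar>X i \<omega>\<bar>))"
      unfolding sum_distrib_left using w by (intro sum.cong) (auto simp: less_imp_neq[symmetric])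
    finally have "exp (s * \<bar>\<Sum>i\<in>I. X i \<omega>\<bar>) \<le> exp (\<Sum>i\<in>I. w i *\<^sub>R ((s / w i) * \<bar>X i \<omega>\<bar>))" by simp
    also have "\<dots> \<le> (\<Sum>i\<in>I. w i * exp ((s / w i) * \<bar>X i \<omega>\<bar>))"
      using w w1 by (intro convex_on_sum[OF I exp_convex]) (auto intro: less_imp_le)
    finally show ?thesis .
  qed
  have "(\<integral>\<^sup>+\<omega>. ennreal (exp (s * \<bar>\<Sum>i\<in>I. X i \<omega>\<bar>)) \<partial>P)
      \<le> (\<integral>\<^sup>+\<omega>. (\<Sum>i\<in>I. ennreal (w i) * ennreal (exp ((s / w i) * \<bar>X i \<omega>\<bar>))) \<partial>P)"
  proof (intro nn_integral_mono)
    fix \<omega>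
    have "ennreal (exp (s * \<bar>\<Sum>i\<in>I. X i \<omega>\<bar>)) \<le> ennreal (\<Sum>i\<in>I. w i * exp ((s / w i) * \<bar>X i \<omega>\<bar>))"
      by (intro ennreal_leI jensen)
    also have "\<dots> = (\<Sum>i\<in>I. ennreal (w i) * ennreal (exp ((s / w i) * \<bar>X i \<omega>\<bar>)))"
      using w by (subst sum_ennreal[symmetric]) (auto simp: ennreal_mult less_imp_le)
    finally show "ennreal (exp (s * \<bar>\<Sum>i\<in>I. X i \<omega>\<bar>)) \<le> \<dots>" .
  qed
  also have "\<dots> = (\<Sum>i\<in>I. ennreal (w i) * (\<integral>\<^sup>+\<omega>. ennreal (exp ((s / w i) * \<bar>X i \<omega>\<bar>)) \<partial>P))"
    by (subst nn_integral_sum) (auto intro!: sum.cong nn_integral_cmult)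
  also have "\<dots> \<le> (\<Sum>i\<in>I. ennreal (w i) * ennreal (2 * exp (s\<^sup>2 * T\<^sup>2 / 2)))"
  proof (intro sum_mono mult_left_mono)
    fix i assume i: "i \<in> I"
    \<comment> \<open>This is the point of the weights: dividing \<open>s\<close> by
      \<open>w i\<close> rescales every \<sigma> to the common value \<open>T\<close>, so all terms
      obey the same bound.\<close>
    have "(s / w i)\<^sup>2 * (\<sigma> i)\<^sup>2 = s\<^sup>2 * T\<^sup>2"
      using \<sigma>[OF i] T by (simp add: w_def power_divide power_mult_distrib)
    then show "(\<integral>\<^sup>+\<omega>. ennreal (exp ((s / w i) * \<bar>X i \<omega>\<bar>)) \<partial>P) \<le> ennreal (2 * exp (s\<^sup>2 * T\<^sup>2 / 2))"
      using subgaussian_le[OF X[OF i], of "s / w i"] s w[OF i] by simp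
  qed simp
  also have "\<dots> = ennreal (2 * exp (s\<^sup>2 * T\<^sup>2 / 2))"
    using w by (simp flip: sum_distrib_right, subst sum_ennreal) (auto simp: w1 less_imp_le)
  finally show "(\<integral>\<^sup>+\<omega>. ennreal (exp (s * \<bar>\<Sum>i\<in>I. X i \<omega>\<bar>)) \<partial>P)
      \<le> ennreal (2 * exp (s\<^sup>2 * (\<Sum>i\<in>I. \<sigma> i)\<^sup>2 / 2))" unfolding T_def .
qed

lemma subgaussian_tail:
  assumes P: "prob_space P" and X: "subgaussian P X \<sigma>" and \<sigma>: "0 < \<sigma>" and t: "0 \<le> t"
  shows "\<P>(\<omega> in P. t \<le> \<bar>X \<omega>\<bar>) \<le> 2 * exp (- (t\<^sup>2 / (2 * \<sigma>\<^sup>2)))"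
proof -
  interpret prob_space P by fact
  note [measurable] = subgaussian_measurable[OF X]
  \<comment> \<open>The minimiser of the Chernoff exponent
    \<open>- (s * t) + s\<^sup>2 * \<sigma>\<^sup>2 / 2\<close>.\<close>
  define s where "s = t / \<sigma>\<^sup>2"
  have s: "0 \<le> s" using t by (simp add: s_def)
  have "emeasure P {\<omega>\<in>space P. t \<le> \<bar>X \<omega>\<bar>}
      \<le> (\<integral>\<^sup>+\<omega>. ennreal (exp (- (s * t))) * ennreal (exp (s * \<bar>X \<omega>\<bar>)) \<partial>P)"
    (is "?p \<le> _")
  proof (subst nn_integral_indicator[symmetric], measurable, intro nn_integral_mono)
    fix \<omega>
    show "indicator {\<omega> \<in> space P. t \<le> \<bar>X \<omega>\<bar>} \<omega> \<le> ennreal (exp (- (s * t))) * ennreal (exp (s * \<bar>X \<omega>\<bar>))"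
    proof (cases "t \<le> \<bar>X \<omega>\<bar>")
      case True
      then have "1 \<le> exp (- (s * t)) * exp (s * \<bar>X \<omega>\<bar>)"
        using s by (simp add: mult_exp_exp mult_left_mono)
      then show ?thesis by (auto simp: indicator_def simp flip: ennreal_mult)
    qed auto
  qed
  also have "\<dots> \<le> ennreal (exp (- (s * t))) * ennreal (2 * exp (s\<^sup>2 * \<sigma>\<^sup>2 / 2))"
    by (subst nn_integral_cmult) (use subgaussian_le[OF X s] in \<open>auto intro: mult_left_mono\<close>)
  also have "\<dots> = ennreal (2 * exp (- (s * t) + s\<^sup>2 * \<sigma>\<^sup>2 / 2))"
    by (subst exp_add) (simp add: mult.left_commute flip: ennreal_mult)
  also have "- (s * t) + s\<^sup>2 * \<sigma>\<^sup>2 / 2 = - (t\<^sup>2 / (2 * \<sigma>\<^sup>2))"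
    using \<sigma> by (simp add: s_def field_simps power2_eq_square)
  finally show ?thesis by (simp add: emeasure_eq_measure)
qed

text \<open>The locale \<^locale>\<open>product_sigma_finite\<close> constrains all indices, so the family is replaced
  by point masses outside \<open>I\<close>.\<close>

lemma PiM_sigma_finite_family:
  assumes K: "\<And>i. i \<in> I \<Longrightarrow> prob_space (K i)"
  shows "\<exists>K'. product_sigma_finite K' \<and> (\<forall>i\<in>I. K' i = K i) \<and> Pi\<^sub>M I K' = Pi\<^sub>M I K"
proof (intro exI conjI ballI)
  define K' where "K' i = (if i \<in> I then K i else return (count_space UNIV) undefined)" for i
  show "product_sigma_finite K'"
    unfolding product_sigma_finite_def K'_def
    using K prob_space_return[of undefined "count_space UNIV"] by (auto intro: prob_space_imp_sigma_finite)
  show "K' i = K i" if "i \<in> I" for i using that by (simp add: K'_def)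
  show "Pi\<^sub>M I K' = Pi\<^sub>M I K" by (intro PiM_cong) (auto simp: K'_def)
qed

lemma nn_integral_PiM_prod:
  assumes I: "finite I" and K: "\<And>i. i \<in> I \<Longrightarrow> prob_space (K i)"
    and f: "\<And>i. i \<in> I \<Longrightarrow> f i \<in> borel_measurable (K i)"
  shows "(\<integral>\<^sup>+x. (\<Prod>i\<in>I. f i (x i)) \<partial>Pi\<^sub>M I K) = (\<Prod>i\<in>I. integral\<^sup>N (K i) (f i))"
proof -
  obtain K' where K': "product_sigma_finite K'" "\<And>i. i \<in> I \<Longrightarrow> K' i = K i" "Pi\<^sub>M I K' = Pi\<^sub>M I K"
    using PiM_sigma_finite_family[of I K] K by blast
  show ?thesis
    using product_sigma_finite.product_nn_integral_prod[OF K'(1) I, of f] f K'(2,3) by simp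
qed

lemma emeasure_PiM_box:
  assumes I: "finite I" and K: "\<And>i. i \<in> I \<Longrightarrow> prob_space (K i)"
    and A: "\<And>i. i \<in> I \<Longrightarrow> A i \<in> sets (K i)"
  shows "emeasure (Pi\<^sub>M I K) (Pi\<^sub>E I A) = (\<Prod>i\<in>I. emeasure (K i) (A i))"
proof -
  obtain K' where K': "product_sigma_finite K'" "\<And>i. i \<in> I \<Longrightarrow> K' i = K i" "Pi\<^sub>M I K' = Pi\<^sub>M I K"
    using PiM_sigma_finite_family[of I K] K by blast
  show ?thesis
    using product_sigma_finite.emeasure_PiM[OF K'(1) I, of A] A K'(2,3) by simp
qed

text \<open>Hoeffding's lemma is applied to each coordinate around its own mean. The factors
  \<open>exp (l * mean)\<close> multiply to 1 because the means sum to zero, so no single coordinate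
  has to be centred.\<close>

lemma subgaussian_average:
  fixes N :: nat
  assumes N: "1 \<le> N" and K: "\<And>i. i < N \<Longrightarrow> K i \<in> space (prob_algebra E)"
    and v: "v \<in> borel_measurable E" "\<And>x. x \<in> space E \<Longrightarrow> \<bar>v x\<bar> \<le> a"
    and centred: "(\<Sum>i<N. \<integral>x. v x \<partial>K i) = 0"
  shows "subgaussian (Pi\<^sub>M {..<N} K) (\<lambda>y. (\<Sum>i<N. v (y i)) / N) (a / sqrt N)"
proof -
  have meas: "(\<lambda>y. (\<Sum>i<N. v (y i)) / N) \<in> borel_measurable (Pi\<^sub>M {..<N} K)"
  proof -
    have [measurable]: "(\<lambda>y. v (y i)) \<in> borel_measurable (Pi\<^sub>M {..<N} K)" if "i < N" for i
      using prob_algebraD[OF K[OF that]] v(1) that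
      by (intro measurable_compose[OF measurable_component_singleton]) (auto cong: measurable_cong_sets)
    show ?thesis by measurable
  qed
  \<comment> \<open>The sign \<open>c\<close> treats \<open>v\<close> and \<open>- v\<close>
    together, one for each tail.\<close>
  have mgf: "(\<integral>\<^sup>+y. ennreal (exp (s * ((\<Sum>i<N. c * v (y i)) / N))) \<partial>Pi\<^sub>M {..<N} K)
      \<le> ennreal (exp (s\<^sup>2 * (a / sqrt N)\<^sup>2 / 2))" if s: "0 < s" and c: "\<bar>c\<bar> = 1" for s c :: real
  proof -
    define l where "l = s / N"
    have l: "0 < l" using s N by (simp add: l_def)
    have single: "(\<integral>\<^sup>+x. ennreal (exp (l * (c * v x))) \<partial>K i)
        \<le> ennreal (exp (l * (\<integral>x. c * v x \<partial>K i)) * exp (l\<^sup>2 * (2 * a)\<^sup>2 / 8))" if i: "i < N" for i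
    proof -
      note Ki = prob_algebraD[OF K[OF i]]
      interpret prob_space "K i" by fact
      have vK: "v \<in> borel_measurable (K i)" using v(1) Ki by (simp cong: measurable_cong_sets)
      have "- a \<le> c * v x \<and> c * v x \<le> a" if "x \<in> space E" for x
        using v(2)[OF that] c abs_eq_iff[of c 1] by (auto simp: abs_le_iff)
      then interpret interval_bounded_random_variable "K i" "\<lambda>x. c * v x" "-a" a
        using vK Ki by unfold_locales auto
      have "(\<integral>\<^sup>+x. ennreal (exp (l * (c * v x))) \<partial>K i)
          = (\<integral>\<^sup>+x. ennreal (exp (l * (\<integral>x. c * v x \<partial>K i))) * ennreal (exp (l * (c * v x - (\<integral>x. c * v x \<partial>K i)))) \<partial>K i)"
        by (simp add: mult_exp_exp algebra_simps flip: ennreal_mult)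
      also have "\<dots> = ennreal (exp (l * (\<integral>x. c * v x \<partial>K i))) * (\<integral>\<^sup>+x. ennreal (exp (l * (c * v x - (\<integral>x. c * v x \<partial>K i)))) \<partial>K i)"
        using vK by (intro nn_integral_cmult) measurable
      also have "\<dots> \<le> ennreal (exp (l * (\<integral>x. c * v x \<partial>K i))) * ennreal (exp (l\<^sup>2 * (a - - a)\<^sup>2 / 8))"
        by (intro mult_left_mono Hoeffdings_lemma_nn_integral l) simp
      finally show ?thesis by (simp flip: ennreal_mult)
    qed
    have "exp (s * ((\<Sum>i<N. c * v (y i)) / N)) = (\<Prod>i<N. exp (l * (c * v (y i))))" for y
      by (subst exp_sum[symmetric]) (auto simp: l_def sum_distrib_left sum_divide_distrib)
    then have "(\<integral>\<^sup>+y. ennreal (exp (s * ((\<Sum>i<N. c * v (y i)) / N))) \<partial>Pi\<^sub>M {..<N} K)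
        = (\<integral>\<^sup>+y. (\<Prod>i<N. ennreal (exp (l * (c * v (y i))))) \<partial>Pi\<^sub>M {..<N} K)"
      by (simp add: prod_ennreal)
    also have "\<dots> = (\<Prod>i<N. (\<integral>\<^sup>+x. ennreal (exp (l * (c * v x))) \<partial>K i))"
    proof (intro nn_integral_PiM_prod)
      fix i assume "i \<in> {..<N}"
      then have i: "i < N" by simp
      note Ki = prob_algebraD[OF K[OF i]]
      show "prob_space (K i)" by fact
      have "v \<in> borel_measurable (K i)" using v(1) Ki by (simp cong: measurable_cong_sets)
      then show "(\<lambda>x. ennreal (exp (l * (c * v x)))) \<in> borel_measurable (K i)" by measurable
    qed simp
    also have "\<dots> \<le> (\<Prod>i<N. ennreal (exp (l * (\<integral>x. c * v x \<partial>K i)) * exp (l\<^sup>2 * (2 * a)\<^sup>2 / 8)))"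
      by (intro prod_mono_ennreal single) simp
    also have "\<dots> = ennreal (exp (l * (\<Sum>i<N. \<integral>x. c * v x \<partial>K i)) * exp (l\<^sup>2 * (2 * a)\<^sup>2 / 8) ^ N)"
      by (simp add: prod_ennreal prod.distrib sum_distrib_left exp_sum)
    also have "(\<Sum>i<N. \<integral>x. c * v x \<partial>K i) = c * (\<Sum>i<N. \<integral>x. v x \<partial>K i)"
      by (simp add: sum_distrib_left)
    \<comment> \<open>The interval from \<open>- a\<close> to \<open>a\<close> has length
      \<open>2 * a\<close>, so each factor is exp (l^2 a^2 / 2); with \<open>l = s / N\<close> the
      \<open>N\<close> factors multiply to exp (s^2 a^2 / (2 N)).\<close>
    also have "exp (l * (c * (\<Sum>i<N. \<integral>x. v x \<partial>K i))) * exp (l\<^sup>2 * (2 * a)\<^sup>2 / 8) ^ N = exp (s\<^sup>2 * (a / sqrt N)\<^sup>2 / 2)"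
      using N by (simp add: centred exp_of_nat_mult[symmetric] l_def field_simps power2_eq_square)
    finally show ?thesis .
  qed
  show ?thesis
    unfolding subgaussian_def
  proof (intro conjI allI impI meas)
    fix s :: real assume s0: "0 \<le> s"
    show "(\<integral>\<^sup>+y. ennreal (exp (s * \<bar>(\<Sum>i<N. v (y i)) / N\<bar>)) \<partial>Pi\<^sub>M {..<N} K)
       \<le> ennreal (2 * exp (s\<^sup>2 * (a / sqrt N)\<^sup>2 / 2))"
    \<comment> \<open>Hoeffding's lemma is used with a strictly positive parameter; at 0 the claim
      reads 1 \<le> 2.\<close>
    proof (cases "s = 0")
      case True
      have "prob_space (Pi\<^sub>M {..<N} K)" using prob_algebraD[OF K] by (intro prob_space_PiM) auto
      then show ?thesis using True by (simp add: prob_space.emeasure_space_1)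
    next
      case False
      then have s: "0 < s" using s0 by simp
      let ?Z = "\<lambda>c y. s * ((\<Sum>i<N. c * v (y i)) / N)"
      have Zm: "(\<lambda>y. ?Z c y) \<in> borel_measurable (Pi\<^sub>M {..<N} K)" for c
        using borel_measurable_times[OF borel_measurable_const[of "s * c"] meas]
        by (simp add: sum_distrib_left[symmetric] mult_ac)
      have "exp (s * \<bar>(\<Sum>i<N. v (y i)) / N\<bar>) \<le> exp (?Z 1 y) + exp (?Z (-1) y)" for y
        by (cases "0 \<le> (\<Sum>i<N. v (y i)) / N") (auto simp: sum_negf abs_if add_increasing add_increasing2)
      then have "(\<integral>\<^sup>+y. ennreal (exp (s * \<bar>(\<Sum>i<N. v (y i)) / N\<bar>)) \<partial>Pi\<^sub>M {..<N} K)
          \<le> (\<integral>\<^sup>+y. ennreal (exp (?Z 1 y)) + ennreal (exp (?Z (-1) y)) \<partial>Pi\<^sub>M {..<N} K)"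
        by (intro nn_integral_mono) (simp flip: ennreal_plus)
      also have "\<dots> = (\<integral>\<^sup>+y. ennreal (exp (?Z 1 y)) \<partial>Pi\<^sub>M {..<N} K) + (\<integral>\<^sup>+y. ennreal (exp (?Z (-1) y)) \<partial>Pi\<^sub>M {..<N} K)"
        by (intro nn_integral_add measurable_compose[OF Zm, of "\<lambda>z. ennreal (exp z)"]) measurable
      also have "\<dots> \<le> ennreal (exp (s\<^sup>2 * (a / sqrt N)\<^sup>2 / 2)) + ennreal (exp (s\<^sup>2 * (a / sqrt N)\<^sup>2 / 2))"
        by (intro add_mono mgf s) auto
      also have "\<dots> = ennreal (2 * exp (s\<^sup>2 * (a / sqrt N)\<^sup>2 / 2))"
        by (simp flip: ennreal_plus)
      finally show ?thesis .
    qed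
  qed
qed

section \<open>Sub-Gaussian bounds under Markov path laws\<close>

context markov_kernels
begin

lemma subgaussian_path_0:
  assumes X: "X \<in> borel_measurable (paths 0)" and sg: "subgaussian \<mu> (\<lambda>x. X (\<lambda>i\<in>{..0}. x)) \<sigma>"
  shows "subgaussian (path_law 0) X \<sigma>"
proof -
  have "(\<lambda>x. \<lambda>i\<in>{..0}. x) \<in> S \<rightarrow>\<^sub>M paths 0" by measurable
  then have m: "(\<lambda>x. \<lambda>i\<in>{..0}. x) \<in> \<mu> \<rightarrow>\<^sub>M paths 0"
    using prob_algebraD[OF init] by (simp cong: measurable_cong_sets)
  note [measurable] = X
  show ?thesis
    using X sg unfolding subgaussian_def markov_path.simps by (subst nn_integral_distr[OF m]) auto
qed

text \<open>A conditional bound whose scale does not depend on the past integrates to an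
  unconditional one. Conditioning means fixing the path \<open>w\<close> and drawing only its next
  state.\<close>

lemma subgaussian_path_Suc:
  assumes X: "X \<in> borel_measurable (paths (Suc n))"
    and sg: "\<And>w. w \<in> space (paths n) \<Longrightarrow> subgaussian (K n (w n)) (\<lambda>x. X (w(Suc n := x))) \<sigma>"
  shows "subgaussian (path_law (Suc n)) X \<sigma>"
  unfolding subgaussian_def
proof (intro conjI allI impI)
  show "X \<in> borel_measurable (path_law (Suc n))"
    using X prob_algebraD[OF path_prob[of "Suc n"]] by (simp cong: measurable_cong_sets)
  fix s :: real assume s: "0 \<le> s"
  interpret prob_space "path_law n" using prob_algebraD[OF path_prob] by simp
  have "(\<integral>\<^sup>+w. ennreal (exp (s * \<bar>X w\<bar>)) \<partial>path_law (Suc n))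
      = (\<integral>\<^sup>+w. \<integral>\<^sup>+x. ennreal (exp (s * \<bar>X (w(Suc n := x))\<bar>)) \<partial>K n (w n) \<partial>path_law n)"
    using X by (intro nn_integral_path_Suc) measurable
  also have "\<dots> \<le> (\<integral>\<^sup>+w. ennreal (2 * exp (s\<^sup>2 * \<sigma>\<^sup>2 / 2)) \<partial>path_law n)"
    using sg s prob_algebraD[OF path_prob[of n]] by (intro nn_integral_mono) (auto intro: subgaussian_le)
  finally show "(\<integral>\<^sup>+w. ennreal (exp (s * \<bar>X w\<bar>)) \<partial>path_law (Suc n)) \<le> ennreal (2 * exp (s\<^sup>2 * \<sigma>\<^sup>2 / 2))"
    by (simp add: emeasure_space_1)
qed

text \<open>States after time \<open>k\<close> integrate out. The lemma brings increments of
  different times onto the one path space of length \<open>n\<close>, where they can be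
  added.\<close>

lemma subgaussian_path_extend:
  assumes k: "k \<le> n" and X: "\<And>j. k \<le> j \<Longrightarrow> X \<in> borel_measurable (paths j)"
    and update: "\<And>w j x. k < j \<Longrightarrow> X (w(j := x)) = X w"
    and sg: "subgaussian (path_law k) X \<sigma>"
  shows "subgaussian (path_law n) X \<sigma>"
  using k
proof (induction n rule: dec_induct)
  case (step n)
  show ?case
    unfolding subgaussian_def
  proof (intro conjI allI impI)
    show "X \<in> borel_measurable (path_law (Suc n))"
      using X[OF le_SucI[OF step.hyps(1)]] prob_algebraD[OF path_prob[of "Suc n"]] by (simp cong: measurable_cong_sets)
    fix s :: real assume s: "0 \<le> s"
    have "(\<integral>\<^sup>+w. ennreal (exp (s * \<bar>X w\<bar>)) \<partial>path_law (Suc n))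
        = (\<integral>\<^sup>+w. \<integral>\<^sup>+x. ennreal (exp (s * \<bar>X (w(Suc n := x))\<bar>)) \<partial>K n (w n) \<partial>path_law n)"
      using X[OF le_SucI[OF step.hyps(1)]] by (intro nn_integral_path_Suc) measurable
    also have "\<dots> = (\<integral>\<^sup>+w. ennreal (exp (s * \<bar>X w\<bar>)) \<partial>path_law n)"
    proof (intro nn_integral_cong)
      fix w assume "w \<in> space (path_law n)"
      then have w: "w \<in> space (paths n)" using prob_algebraD[OF path_prob[of n]] by simp
      interpret prob_space "K n (w n)" using prob_algebraD[OF K_path[OF w]] by simp
      show "(\<integral>\<^sup>+x. ennreal (exp (s * \<bar>X (w(Suc n := x))\<bar>)) \<partial>K n (w n)) = ennreal (exp (s * \<bar>X w\<bar>))"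
        using step by (simp add: update emeasure_space_1)
    qed
    also have "\<dots> \<le> ennreal (2 * exp (s\<^sup>2 * \<sigma>\<^sup>2 / 2))" using subgaussian_le[OF step.IH s] .
    finally show "(\<integral>\<^sup>+w. ennreal (exp (s * \<bar>X w\<bar>)) \<partial>path_law (Suc n)) \<le> ennreal (2 * exp (s\<^sup>2 * \<sigma>\<^sup>2 / 2))" .
  qed
qed (rule sg)

end

section \<open>The kernels of the particle model\<close>

text \<open>Integrals serve as the criterion because those of the particle kernels are explicit
  weighted sums, visibly measurable in the parameter.\<close>

lemma measurable_prob_algebra_integralI:
  assumes K: "\<And>a. a \<in> space M \<Longrightarrow> K a \<in> space (prob_algebra N)"
    and ind: "\<And>A. A \<in> sets N \<Longrightarrow> (\<lambda>a. \<integral>x. indicat_real A x \<partial>K a) \<in> borel_measurable M"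
  shows "K \<in> M \<rightarrow>\<^sub>M prob_algebra N"
proof (rule measurable_prob_algebraI)
  show "prob_space (K a)" if "a \<in> space M" for a using prob_algebraD[OF K[OF that]] by simp
  show "K \<in> M \<rightarrow>\<^sub>M subprob_algebra N"
  proof (rule measurable_subprob_algebra)
    fix a assume a: "a \<in> space M"
    note Ka = prob_algebraD[OF K[OF a]]
    show "subprob_space (K a)" "sets (K a) = sets N" using Ka by (auto intro: prob_space_imp_subprob_space)
  next
    fix A assume A: "A \<in> sets N"
    have "emeasure (K a) A = ennreal (\<integral>x. indicat_real A x \<partial>K a)" if a: "a \<in> space M" for a
    proof -
      note Ka = prob_algebraD[OF K[OF a]]
      interpret prob_space "K a" by fact
      have "A \<inter> space (K a) = A" using sets.sets_into_space[OF A] Ka by auto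
      then show ?thesis using A Ka by (simp add: emeasure_eq_measure)
    qed
    then show "(\<lambda>a. emeasure (K a) A) \<in> borel_measurable M"
      using ind[OF A] by (subst measurable_cong[where g = "\<lambda>a. ennreal (\<integral>x. indicat_real A x \<partial>K a)"]) auto
  qed
qed

lemma bounded_measurable_indicator: "A \<in> sets M \<Longrightarrow> indicat_real A \<in> bounded_measurable M"
  by (rule bounded_measurableI[where B = 1]) (auto simp: indicator_def)

section \<open>Boltzmann transforms and mixtures\<close>

lemma boltzmann_prob_algebra:
  assumes \<mu>: "\<mu> \<in> space (prob_algebra M)" and g: "g \<in> bounded_measurable M"
    and nonneg: "\<And>x. x \<in> space M \<Longrightarrow> 0 \<le> g x" and pos: "0 < (\<integral>x. g x \<partial>\<mu>)"
  shows "boltzmann g \<mu> \<in> space (prob_algebra M)"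
proof -
  note P = prob_algebraD[OF \<mu>]
  have [measurable]: "g \<in> borel_measurable \<mu>"
    using bounded_measurable_measurable[OF g] P by (simp cong: measurable_cong_sets)
  have "emeasure (boltzmann g \<mu>) (space \<mu>) = (\<integral>\<^sup>+x. ennreal (g x / (\<integral>y. g y \<partial>\<mu>)) \<partial>\<mu>)"
    unfolding boltzmann_def by (subst emeasure_density) (auto intro!: nn_integral_cong)
  also have "\<dots> = ennreal (\<integral>x. g x / (\<integral>y. g y \<partial>\<mu>) \<partial>\<mu>)"
    using nonneg pos P integrable_bounded_measurable[OF \<mu> g]
    by (intro nn_integral_eq_integral) (auto intro!: AE_I2 divide_nonneg_pos)
  also have "\<dots> = 1" using pos by simp
  finally have "emeasure (boltzmann g \<mu>) (space (boltzmann g \<mu>)) = 1" by (simp add: boltzmann_def)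
  then show ?thesis
    using P unfolding space_prob_algebra by (auto simp: boltzmann_def intro: prob_spaceI)
qed

lemma integral_boltzmann:
  assumes \<mu>: "\<mu> \<in> space (prob_algebra M)" and g: "g \<in> bounded_measurable M"
    and nonneg: "\<And>x. x \<in> space M \<Longrightarrow> 0 \<le> g x" and pos: "0 < (\<integral>x. g x \<partial>\<mu>)"
    and \<phi>: "\<phi> \<in> bounded_measurable M"
  shows "(\<integral>x. \<phi> x \<partial>boltzmann g \<mu>) = (\<integral>x. g x * \<phi> x \<partial>\<mu>) / (\<integral>x. g x \<partial>\<mu>)"
proof -
  note P = prob_algebraD[OF \<mu>]
  have [measurable]: "g \<in> borel_measurable \<mu>" "\<phi> \<in> borel_measurable \<mu>"
    using bounded_measurable_measurable[OF g] bounded_measurable_measurable[OF \<phi>] P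
    by (simp_all cong: measurable_cong_sets)
  have "(\<integral>x. \<phi> x \<partial>boltzmann g \<mu>) = (\<integral>x. (g x / (\<integral>y. g y \<partial>\<mu>)) *\<^sub>R \<phi> x \<partial>\<mu>)"
    unfolding boltzmann_def
    using nonneg pos P by (intro integral_density) (auto intro!: AE_I2 divide_nonneg_pos)
  then show ?thesis by simp
qed

text \<open>A measure given by \<open>measure_of\<close> takes the prescribed values only once
  countable additivity is known. Tossing a coin and then sampling is a genuine measure with these
  values, and it yields the integral formula too.\<close>

lemma mixture_eq_bind:
  assumes p: "0 \<le> p" "p \<le> 1" and \<mu>: "\<mu> \<in> space (prob_algebra M)" and \<nu>: "\<nu> \<in> space (prob_algebra M)"
  shows "mixture p \<mu> \<nu> = measure_pmf (bernoulli_pmf p) \<bind> (\<lambda>b. if b then \<mu> else \<nu>)" (is "_ = ?B")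
proof -
  note P = prob_algebraD[OF \<mu>]
  have k: "(\<lambda>b. if b then \<mu> else \<nu>) \<in> measure_pmf (bernoulli_pmf p) \<rightarrow>\<^sub>M prob_algebra M"
    using \<mu> \<nu> by (auto simp: measurable_def)
  have b: "measure_pmf (bernoulli_pmf p) \<in> space (prob_algebra (measure_pmf (bernoulli_pmf p)))"
    by (auto simp: space_prob_algebra intro: measure_pmf.prob_space_axioms)
  have B: "sets ?B = sets \<mu>" "space ?B = space \<mu>"
    using prob_algebraD[OF bind_prob_algebra[OF b k]] P by auto
  have "mixture p \<mu> \<nu> = measure_of (space \<mu>) (sets \<mu>) (emeasure ?B)"
    unfolding mixture_def
  proof (rule measure_of_eq)
    show "sets \<mu> \<subseteq> Pow (space \<mu>)" by (rule sets.space_closed)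
    fix A assume "A \<in> sigma_sets (space \<mu>) (sets \<mu>)"
    then have A: "A \<in> sets M" using P by (simp add: sets.sigma_sets_eq)
    show "ennreal p * emeasure \<mu> A + ennreal (1 - p) * emeasure \<nu> A = emeasure ?B A"
      using p by (subst emeasure_bind_prob_algebra[OF b k A]) (simp add: mult.commute)
  qed
  also have "\<dots> = ?B" using measure_of_of_measure[of ?B] B by simp
  finally show ?thesis .
qed

lemma
  assumes p: "0 \<le> p" "p \<le> 1" and \<mu>: "\<mu> \<in> space (prob_algebra M)" and \<nu>: "\<nu> \<in> space (prob_algebra M)"
  shows mixture_prob_algebra: "mixture p \<mu> \<nu> \<in> space (prob_algebra M)"
    and integral_mixture: "\<phi> \<in> bounded_measurable M \<Longrightarrow>
      (\<integral>x. \<phi> x \<partial>mixture p \<mu> \<nu>) = p * (\<integral>x. \<phi> x \<partial>\<mu>) + (1 - p) * (\<integral>x. \<phi> x \<partial>\<nu>)"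
proof -
  have k: "(\<lambda>b. if b then \<mu> else \<nu>) \<in> measure_pmf (bernoulli_pmf p) \<rightarrow>\<^sub>M prob_algebra M"
    using \<mu> \<nu> by (auto simp: measurable_def)
  have b: "measure_pmf (bernoulli_pmf p) \<in> space (prob_algebra (measure_pmf (bernoulli_pmf p)))"
    by (auto simp: space_prob_algebra intro: measure_pmf.prob_space_axioms)
  show "mixture p \<mu> \<nu> \<in> space (prob_algebra M)"
    unfolding mixture_eq_bind[OF assms] by (rule bind_prob_algebra[OF b k])
  show "(\<integral>x. \<phi> x \<partial>mixture p \<mu> \<nu>) = p * (\<integral>x. \<phi> x \<partial>\<mu>) + (1 - p) * (\<integral>x. \<phi> x \<partial>\<nu>)"
    if "\<phi> \<in> bounded_measurable M"
    unfolding mixture_eq_bind[OF assms] integral_bind_bounded[OF b k that] using p by simp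
qed

section \<open>Empirical measures and the particle transition\<close>

lemma particle_space_coord: "x \<in> space (particle_space E N) \<Longrightarrow> i < N \<Longrightarrow> x i \<in> space E"
  unfolding particle_space_def by (auto simp: space_PiM)

lemma measurable_particle_coord: "i < N \<Longrightarrow> (\<lambda>x. x i) \<in> particle_space E N \<rightarrow>\<^sub>M E"
  unfolding particle_space_def by (rule measurable_component_singleton) simp

lemma
  assumes N: "1 \<le> N" and x: "x \<in> space (particle_space E N)"
  shows empirical_prob_algebra: "empirical E N x \<in> space (prob_algebra E)"
    and integral_empirical: "\<phi> \<in> borel_measurable E \<Longrightarrow>
      (\<integral>y. \<phi> y \<partial>empirical E N x) = (\<Sum>i<N. \<phi> (x i)) / N"
proof -
  have "space (uniform_count_measure {..<N}) = {..<N}" by (rule space_uniform_count_measure)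
  then have m: "x \<in> uniform_count_measure {..<N} \<rightarrow>\<^sub>M E"
    using particle_space_coord[OF x] by (auto simp: measurable_def sets_uniform_count_measure)
  have "prob_space (uniform_count_measure {..<N})"
    using N by (intro prob_space_uniform_count_measure) (auto simp: lessThan_empty_iff)
  then show "empirical E N x \<in> space (prob_algebra E)"
    using m unfolding empirical_def space_prob_algebra by (auto intro: prob_space.prob_space_distr)
  show "(\<integral>y. \<phi> y \<partial>empirical E N x) = (\<Sum>i<N. \<phi> (x i)) / N" if "\<phi> \<in> borel_measurable E"
    unfolding empirical_def using that m by (simp add: integral_distr integral_uniform_count_measure)
qed

text \<open>The self-normalised particle average. For \<open>w = G\<close> it is the mean of
  \<open>u\<close> under \<Psi>_G of the empirical measure, for \<open>w z = G z * H z y\<close> the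
  mean under the backward kernel at \<open>y\<close>.\<close>

definition weighted_mean :: "nat \<Rightarrow> ('a \<Rightarrow> real) \<Rightarrow> ('a \<Rightarrow> real) \<Rightarrow> (nat \<Rightarrow> 'a) \<Rightarrow> real" where
  "weighted_mean N w u x = (\<Sum>i<N. w (x i) * u (x i)) / (\<Sum>i<N. w (x i))"

locale particle_model = feynman_kac_model E \<eta>0 M G H lam
  for E \<eta>0 lam :: "'a measure" and M :: "'a \<Rightarrow> 'a measure"
    and G :: "'a \<Rightarrow> real" and H :: "'a \<Rightarrow> 'a \<Rightarrow> real" +
  fixes eps :: "nat \<Rightarrow> real" and N :: nat
  assumes eps_nonneg: "0 \<le> eps n" and eps_le: "x \<in> space E \<Longrightarrow> eps n * G x \<le> 1" and N_pos: "1 \<le> N"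
begin

abbreviation "S \<equiv> particle_space E N"

lemma initial_prob_algebra: "\<eta>0 \<in> space (prob_algebra E)"
  using initial by (simp add: space_prob_algebra)

lemma G_bounded: "G \<in> bounded_measurable E"
  using potential_measurable potential_range by (intro bounded_measurableI[where B = 1]) (auto simp: less_imp_le)

lemma sum_particles_pos:
  fixes g :: "'a \<Rightarrow> real"
  assumes "x \<in> space S" "\<And>y. y \<in> space E \<Longrightarrow> 0 < g y"
  shows "0 < (\<Sum>i<N. g (x i))"
  using N_pos assms particle_space_coord[OF assms(1)] by (intro sum_pos) (auto simp: lessThan_empty_iff)

lemma integral_G_pos:
  assumes x: "x \<in> space S"
  shows "0 < (\<integral>y. G y \<partial>empirical E N x)"
  using sum_particles_pos[OF x, of G] potential_range N_pos
  by (subst integral_empirical[OF N_pos x potential_measurable]) auto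

lemma FK_map_prob_algebra:
  assumes x: "x \<in> space S"
  shows "FK_map M G (empirical E N x) \<in> space (prob_algebra E)"
  unfolding FK_map_def using potential_range
  by (intro bind_prob_algebra[OF _ transition] boltzmann_prob_algebra[OF empirical_prob_algebra[OF N_pos x] G_bounded]
      integral_G_pos[OF x]) (auto simp: less_imp_le)

lemma integral_FK_map:
  assumes x: "x \<in> space S" and \<phi>: "\<phi> \<in> bounded_measurable E"
  shows "(\<integral>y. \<phi> y \<partial>FK_map M G (empirical E N x)) = weighted_mean N G (\<lambda>z. \<integral>y. \<phi> y \<partial>M z) x"
proof -
  note emp = empirical_prob_algebra[OF N_pos x]
  have G0: "0 \<le> G y" if "y \<in> space E" for y using potential_range[OF that] by simp
  note M\<phi> = kernel_integral_bounded_measurable[OF transition \<phi>]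
  have "(\<integral>y. \<phi> y \<partial>FK_map M G (empirical E N x)) = (\<integral>z. \<integral>y. \<phi> y \<partial>M z \<partial>boltzmann G (empirical E N x))"
    unfolding FK_map_def
    by (rule integral_bind_bounded[OF boltzmann_prob_algebra[OF emp G_bounded G0 integral_G_pos[OF x]] transition \<phi>])
  also have "\<dots> = (\<integral>z. G z * (\<integral>y. \<phi> y \<partial>M z) \<partial>empirical E N x) / (\<integral>z. G z \<partial>empirical E N x)"
    by (rule integral_boltzmann[OF emp G_bounded G0 integral_G_pos[OF x] M\<phi>])
  also have "\<dots> = weighted_mean N G (\<lambda>z. \<integral>y. \<phi> y \<partial>M z) x"
    using N_pos bounded_measurable_measurable[OF bounded_measurable_mult[OF G_bounded M\<phi>]]
    by (simp add: integral_empirical[OF N_pos x] potential_measurable weighted_mean_def)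
  finally show ?thesis .
qed

lemma
  assumes x: "x \<in> space S" and z: "z \<in> space E"
  shows mckean_prob_algebra: "mckean_kernel M G eps n (empirical E N x) z \<in> space (prob_algebra E)"
    and integral_mckean: "\<phi> \<in> bounded_measurable E \<Longrightarrow>
      (\<integral>y. \<phi> y \<partial>mckean_kernel M G eps n (empirical E N x) z) =
        eps n * G z * (\<integral>y. \<phi> y \<partial>M z) + (1 - eps n * G z) * weighted_mean N G (\<lambda>z. \<integral>y. \<phi> y \<partial>M z) x"
proof -
  have p: "0 \<le> eps n * G z" "eps n * G z \<le> 1"
    using eps_nonneg[of n] eps_le[OF z, of n] potential_range[OF z] by auto
  note Mz = measurable_space[OF transition z]
  show "mckean_kernel M G eps n (empirical E N x) z \<in> space (prob_algebra E)"
    unfolding mckean_kernel_def by (rule mixture_prob_algebra[OF p Mz FK_map_prob_algebra[OF x]])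
  show "(\<integral>y. \<phi> y \<partial>mckean_kernel M G eps n (empirical E N x) z) =
        eps n * G z * (\<integral>y. \<phi> y \<partial>M z) + (1 - eps n * G z) * weighted_mean N G (\<lambda>z. \<integral>y. \<phi> y \<partial>M z) x"
    if "\<phi> \<in> bounded_measurable E"
    unfolding mckean_kernel_def
    by (simp add: integral_mixture[OF p Mz FK_map_prob_algebra[OF x] that] integral_FK_map[OF x that])
qed

text \<open>The terms carrying \<open>eps n\<close> are multiples of \<open>G (x i)\<close> times
  the deviation of the \<open>M\<close>-mean at \<open>x i\<close> from its
  \<open>G\<close>-weighted average, and these sum to zero. So the kernels of the particles differ,
  but their average is \<Phi> of the empirical measure for every \<open>eps\<close>.\<close>

lemma sum_integral_mckean:
  assumes x: "x \<in> space S" and \<phi>: "\<phi> \<in> bounded_measurable E"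
  shows "(\<Sum>i<N. \<integral>y. \<phi> y \<partial>mckean_kernel M G eps n (empirical E N x) (x i)) =
    N * weighted_mean N G (\<lambda>z. \<integral>y. \<phi> y \<partial>M z) x"
proof -
  let ?m = "weighted_mean N G (\<lambda>z. \<integral>y. \<phi> y \<partial>M z) x"
  have G: "(\<Sum>i<N. G (x i)) \<noteq> 0" using sum_particles_pos[OF x, of G] potential_range by force
  then have m: "(\<Sum>i<N. G (x i) * (\<integral>y. \<phi> y \<partial>M (x i))) = ?m * (\<Sum>i<N. G (x i))"
    by (simp add: weighted_mean_def)
  have "(\<Sum>i<N. \<integral>y. \<phi> y \<partial>mckean_kernel M G eps n (empirical E N x) (x i)) =
    (\<Sum>i<N. eps n * (G (x i) * (\<integral>y. \<phi> y \<partial>M (x i))) + (?m - eps n * ?m * G (x i)))"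
    by (intro sum.cong refl) (auto simp: integral_mckean[OF x particle_space_coord[OF x] \<phi>] algebra_simps)
  also have "\<dots> = eps n * (\<Sum>i<N. G (x i) * (\<integral>y. \<phi> y \<partial>M (x i))) + (N * ?m - eps n * ?m * (\<Sum>i<N. G (x i)))"
    by (simp add: sum.distrib sum_subtractf sum_distrib_left)
  also have "\<dots> = N * ?m" unfolding m by simp
  finally show ?thesis .
qed

lemma measurable_particle_comp: "i < N \<Longrightarrow> \<phi> \<in> borel_measurable E \<Longrightarrow> (\<lambda>x. \<phi> (x i)) \<in> borel_measurable S"
  by (rule measurable_compose[OF measurable_particle_coord])

lemma measurable_weighted_mean:
  assumes "w \<in> borel_measurable E" "u \<in> borel_measurable E"
  shows "weighted_mean N w u \<in> borel_measurable S"
  unfolding weighted_mean_def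
  by (intro borel_measurable_divide borel_measurable_sum borel_measurable_times measurable_particle_comp assms) auto

lemma measurable_mckean:
  assumes i: "i < N"
  shows "(\<lambda>x. mckean_kernel M G eps n (empirical E N x) (x i)) \<in> S \<rightarrow>\<^sub>M prob_algebra E"
proof (rule measurable_prob_algebra_integralI)
  fix x assume x: "x \<in> space S"
  then show "mckean_kernel M G eps n (empirical E N x) (x i) \<in> space (prob_algebra E)"
    using particle_space_coord[OF x i] by (rule mckean_prob_algebra)
next
  fix A assume "A \<in> sets E"
  note \<phi> = bounded_measurable_indicator[OF this]
  note M\<phi> = bounded_measurable_measurable[OF kernel_integral_bounded_measurable[OF transition \<phi>]]
  have "(\<lambda>x. eps n * G (x i) * (\<integral>y. indicat_real A y \<partial>M (x i)) +
      (1 - eps n * G (x i)) * weighted_mean N G (\<lambda>z. \<integral>y. indicat_real A y \<partial>M z) x) \<in> borel_measurable S"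
    using M\<phi> potential_measurable i
    by (intro borel_measurable_add borel_measurable_times borel_measurable_diff borel_measurable_const
        measurable_weighted_mean measurable_particle_comp) auto
  then show "(\<lambda>x. \<integral>y. indicat_real A y \<partial>mckean_kernel M G eps n (empirical E N x) (x i)) \<in> borel_measurable S"
    by (subst measurable_cong[OF integral_mckean[OF _ particle_space_coord[OF _ i] \<phi>]]) auto
qed

text \<open>It suffices to test boxes, which generate the product sets and are stable under
  intersection; there the measure is a finite product of measurable factors.\<close>

lemma measurable_particle_kernel: "particle_kernel E M G eps N n \<in> S \<rightarrow>\<^sub>M prob_algebra S"
proof -
  let ?K = "\<lambda>x i. mckean_kernel M G eps n (empirical E N x) (x i)"
  have K: "?K x i \<in> space (prob_algebra E)" if "x \<in> space S" "i < N" for x i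
    using mckean_prob_algebra[OF that(1) particle_space_coord[OF that]] .
  show ?thesis
  proof (rule measurable_prob_algebra_generated)
    show "sets S = sigma_sets (\<Pi>\<^sub>E i\<in>{..<N}. space E) (prod_algebra {..<N} (\<lambda>_. E))"
      unfolding particle_space_def by (rule sets_PiM)
    show "Int_stable (prod_algebra {..<N} (\<lambda>_. E))" by (rule Int_stable_prod_algebra)
    show "prod_algebra {..<N} (\<lambda>_. E) \<subseteq> Pow (\<Pi>\<^sub>E i\<in>{..<N}. space E)"
      by (rule prod_algebra_sets_into_space)
    fix x assume x: "x \<in> space S"
    show "prob_space (particle_kernel E M G eps N n x)"
      unfolding particle_kernel_def using prob_algebraD[OF K[OF x]] by (intro prob_space_PiM) auto
    show "sets (particle_kernel E M G eps N n x) = sets S"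
      unfolding particle_kernel_def particle_space_def using prob_algebraD[OF K[OF x]]
      by (intro sets_PiM_cong) auto
  next
    fix B assume "B \<in> prod_algebra {..<N} (\<lambda>_. E)"
    then obtain A where B: "B = Pi\<^sub>E {..<N} A" and A: "\<And>i. i < N \<Longrightarrow> A i \<in> sets E"
      by (auto simp: prod_algebra_eq_finite)
    have "emeasure (particle_kernel E M G eps N n x) B = (\<Prod>i<N. emeasure (?K x i) (A i))"
      if x: "x \<in> space S" for x
      unfolding particle_kernel_def B using prob_algebraD[OF K[OF x]] A by (intro emeasure_PiM_box) auto
    moreover have "(\<lambda>x. \<Prod>i<N. emeasure (?K x i) (A i)) \<in> borel_measurable S"
    proof (intro borel_measurable_prod_ennreal)
      fix i assume "i \<in> {..<N}"
      then have i: "i < N" by simp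
      show "(\<lambda>x. emeasure (?K x i) (A i)) \<in> borel_measurable S"
        using measurable_compose[OF measurable_prob_algebraD[OF measurable_mckean[OF i]]
            measurable_emeasure_subprob_algebra[OF A[OF i]]] .
    qed
    ultimately show "(\<lambda>x. emeasure (particle_kernel E M G eps N n x) B) \<in> borel_measurable S"
      by (subst measurable_cong) auto
  qed
qed

lemma particle_markov_kernels: "markov_kernels S (Pi\<^sub>M {..<N} (\<lambda>_. \<eta>0)) (particle_kernel E M G eps N)"
proof
  show "Pi\<^sub>M {..<N} (\<lambda>_. \<eta>0) \<in> space (prob_algebra S)"
    unfolding space_prob_algebra particle_space_def
    using initial by (auto intro!: prob_space_PiM sets_PiM_cong)
qed (rule measurable_particle_kernel)

end

section \<open>Mixing\<close>

text \<open>Stands in for the oscillation: the contraction arguments work with the two endpoints,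
  and no supremum has to be evaluated.\<close>

definition band :: "'a measure \<Rightarrow> ('a \<Rightarrow> real) \<Rightarrow> real \<Rightarrow> bool" where
  "band M u D \<longleftrightarrow> (\<exists>lo. \<forall>x\<in>space M. lo \<le> u x \<and> u x \<le> lo + D)"

text \<open>One factor \<theta> comes from comparing the numerators above \<open>lo\<close> and
  below \<open>hi\<close>, the other from comparing the denominators. Both bounds refer to the same
  value \<open>A' / B'\<close>, so all ratios lie in an interval of length (1 - \<theta>^2) (hi -
  lo).\<close>

lemma ratio_contraction:
  fixes A B A' B' lo hi \<theta> :: real
  assumes pos: "0 < B" "0 < B'" "0 < \<theta>" and mass: "\<theta> * B \<le> B'"
    and range: "lo * B' \<le> A'" "A' \<le> hi * B'"
    and lower: "\<theta> * (A' - lo * B') \<le> A - lo * B" and upper: "\<theta> * (hi * B' - A') \<le> hi * B - A"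
  shows "lo + \<theta>\<^sup>2 * (A' / B' - lo) \<le> A / B" "A / B \<le> hi - \<theta>\<^sup>2 * (hi - A' / B')"
proof -
  have inv: "\<theta> / B' \<le> 1 / B" using pos mass by (simp add: field_simps)
  have "\<theta>\<^sup>2 * (A' / B' - lo) = (\<theta> / B') * (\<theta> * (A' - lo * B'))"
    using pos by (simp add: field_simps power2_eq_square)
  also have "\<dots> \<le> (1 / B) * (\<theta> * (A' - lo * B'))"
    using inv pos range by (intro mult_right_mono) auto
  also have "\<dots> \<le> (1 / B) * (A - lo * B)" using lower pos by (intro mult_left_mono) auto
  also have "\<dots> = A / B - lo" using pos by (simp add: field_simps)
  finally show "lo + \<theta>\<^sup>2 * (A' / B' - lo) \<le> A / B" by simp
  have "\<theta>\<^sup>2 * (hi - A' / B') = (\<theta> / B') * (\<theta> * (hi * B' - A'))"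
    using pos by (simp add: field_simps power2_eq_square)
  also have "\<dots> \<le> (1 / B) * (\<theta> * (hi * B' - A'))"
    using inv pos range by (intro mult_right_mono) auto
  also have "\<dots> \<le> (1 / B) * (hi * B - A)" using upper pos by (intro mult_left_mono) auto
  also have "\<dots> = hi - A / B" using pos by (simp add: field_simps)
  finally show "A / B \<le> hi - \<theta>\<^sup>2 * (hi - A' / B')" by simp
qed

lemma weighted_mean_range:
  assumes w: "\<And>i. i < N \<Longrightarrow> 0 < w (x i)" and N: "1 \<le> N"
    and u: "\<And>i. i < N \<Longrightarrow> lo \<le> u (x i)" "\<And>i. i < N \<Longrightarrow> u (x i) \<le> hi"
  shows "lo \<le> weighted_mean N w u x" "weighted_mean N w u x \<le> hi"
proof -
  have pos: "0 < (\<Sum>i<N. w (x i))" using w N by (intro sum_pos) (auto simp: lessThan_empty_iff)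
  have "(\<Sum>i<N. w (x i) * lo) \<le> (\<Sum>i<N. w (x i) * u (x i))" "(\<Sum>i<N. w (x i) * u (x i)) \<le> (\<Sum>i<N. w (x i) * hi)"
    using w u by (auto intro!: sum_mono mult_left_mono simp: less_imp_le)
  then show "lo \<le> weighted_mean N w u x" "weighted_mean N w u x \<le> hi"
    using pos by (simp_all add: weighted_mean_def pos_le_divide_eq pos_divide_le_eq mult.commute sum_distrib_left)
qed

text \<open>\<open>H_source\<close> makes the forward chain contract, \<open>H_target\<close> the
  backward kernels; one constant serves both. Strictness of \<open>\<theta> < 1\<close> keeps
  \<open>r\<close> positive, since \<open>subgaussian_sum\<close> asks for positive scales.\<close>

locale mixing_model = particle_model +
  fixes \<theta> \<delta> :: real
  assumes \<theta>: "0 < \<theta>" "\<theta> < 1" and \<delta>: "1 \<le> \<delta>"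
    and H_target: "x \<in> space E \<Longrightarrow> y \<in> space E \<Longrightarrow> y' \<in> space E \<Longrightarrow> \<theta> * H x y' \<le> H x y"
    and H_source: "x \<in> space E \<Longrightarrow> x' \<in> space E \<Longrightarrow> y \<in> space E \<Longrightarrow> \<theta> * H x' y \<le> H x y"
    and G_ratio: "x \<in> space E \<Longrightarrow> x' \<in> space E \<Longrightarrow> G x \<le> \<delta> * G x'"
begin

definition "r = 1 - \<theta>\<^sup>2"

lemma r: "0 < r" "r < 1"
  using \<theta> by (auto simp: r_def abs_square_less_1)

definition "\<kappa> = \<delta> / \<theta>"

lemma \<kappa>: "1 \<le> \<kappa>"
  using \<theta> \<delta> by (simp add: \<kappa>_def field_simps)

lemma E_nonempty: "\<exists>x. x \<in> space E"
  using prob_space.not_empty[OF initial(1)] sets_eq_imp_space_eq[OF initial(2)] by auto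

lemma M_prob_algebra: "x \<in> space E \<Longrightarrow> M x \<in> space (prob_algebra E)"
  using measurable_space[OF transition] .

text \<open>Changing first the source and then the target leads from \<open>H x y\<close> to the
  fixed number \<open>H x0 x0\<close>, each change costing a factor \<theta>.\<close>

lemma H_bounded: "(\<lambda>(x, y). H x y) \<in> bounded_measurable (E \<Otimes>\<^sub>M E)"
proof -
  obtain x0 where x0: "x0 \<in> space E" using E_nonempty by blast
  show ?thesis
  proof (rule bounded_measurableI[OF density_measurable])
    fix z assume "z \<in> space (E \<Otimes>\<^sub>M E)"
    then obtain x y where z: "z = (x, y)" "x \<in> space E" "y \<in> space E" by (auto simp: space_pair_measure)
    have "\<theta> * (\<theta> * H x y) \<le> \<theta> * H x0 y"
      using H_source[OF x0 z(2,3)] \<theta> by (intro mult_left_mono) auto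
    also have "\<dots> \<le> H x0 x0" using H_target[OF x0 x0 z(3)] .
    finally have "\<theta> * (\<theta> * H x y) \<le> H x0 x0" .
    then have "H x y \<le> H x0 x0 / (\<theta> * \<theta>)" using \<theta> by (simp add: field_simps)
    then show "\<bar>case z of (x, y) \<Rightarrow> H x y\<bar> \<le> H x0 x0 / (\<theta> * \<theta>)" using density_pos[of x y] z by simp
  qed
qed

lemma H_row: "x \<in> space E \<Longrightarrow> H x \<in> bounded_measurable E"
  using bounded_measurable_comp[OF H_bounded measurable_Pair1'] by auto

lemma H_col: "y \<in> space E \<Longrightarrow> (\<lambda>x. H x y) \<in> bounded_measurable E"
  using bounded_measurable_comp[OF H_bounded measurable_Pair2'] by auto

lemma
  assumes x: "x \<in> space E" and \<phi>: "\<phi> \<in> bounded_measurable E"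
  shows integrable_M: "integrable lam (\<lambda>y. H x y * \<phi> y)"
    and integral_M: "(\<integral>y. \<phi> y \<partial>M x) = (\<integral>y. H x y * \<phi> y \<partial>lam)"
proof -
  have sp: "space lam = space E" using reference by (auto dest: sets_eq_imp_space_eq)
  have m: "H x \<in> borel_measurable lam" "\<phi> \<in> borel_measurable lam"
    using bounded_measurable_measurable[OF H_row[OF x]] bounded_measurable_measurable[OF \<phi>] reference(2)
    by (simp_all cong: measurable_cong_sets)
  have ae: "AE y in lam. 0 \<le> H x y" using density_pos[OF x] sp by (auto intro!: AE_I2 less_imp_le)
  show "integrable lam (\<lambda>y. H x y * \<phi> y)"
    using integrable_bounded_measurable[OF M_prob_algebra[OF x] \<phi>] integrable_density[OF m(2,1) ae]
    unfolding transition_density[OF x] by simp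
  show "(\<integral>y. \<phi> y \<partial>M x) = (\<integral>y. H x y * \<phi> y \<partial>lam)"
    unfolding transition_density[OF x] using integral_density[OF m(2,1) ae] by simp
qed

lemma M_minorization:
  assumes x: "x \<in> space E" "x' \<in> space E" and \<phi>: "\<phi> \<in> bounded_measurable E"
    and nonneg: "\<And>y. y \<in> space E \<Longrightarrow> 0 \<le> \<phi> y"
  shows "\<theta> * (\<integral>y. \<phi> y \<partial>M x') \<le> (\<integral>y. \<phi> y \<partial>M x)"
proof -
  have sp: "space lam = space E" using reference by (auto dest: sets_eq_imp_space_eq)
  have "\<theta> * (\<integral>y. \<phi> y \<partial>M x') = (\<integral>y. \<theta> * (H x' y * \<phi> y) \<partial>lam)"
    by (simp add: integral_M[OF x(2) \<phi>])
  also have "\<dots> \<le> (\<integral>y. H x y * \<phi> y \<partial>lam)"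
  proof (intro integral_mono integrable_mult_right integrable_M x \<phi>)
    fix y assume "y \<in> space lam"
    then show "\<theta> * (H x' y * \<phi> y) \<le> H x y * \<phi> y"
      using mult_right_mono[OF H_source[OF x, of y] nonneg[of y]] sp by (simp add: mult.assoc)
  qed
  finally show ?thesis by (simp add: integral_M[OF x(1) \<phi>])
qed

text \<open>\<open>W j x\<close> is the expected weight \<open>\<E> (\<Prod>q<j. G (X\<^sub>q))\<close> of a path of length \<open>j\<close> from \<open>x\<close>.\<close>

primrec W :: "nat \<Rightarrow> 'a \<Rightarrow> real" where
  "W 0 = (\<lambda>_. 1)"
| "W (Suc j) = (\<lambda>x. G x * (\<integral>y. W j y \<partial>M x))"

lemma W_bounded: "W j \<in> bounded_measurable E"
  by (induction j)
    (auto intro!: bounded_measurable_mult[OF G_bounded] kernel_integral_bounded_measurable[OF transition])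

text \<open>A uniform bound, unlike pointwise positivity, passes to integrals by monotonicity alone;
  it keeps all later normalisers positive.\<close>

lemma W_lower: "\<exists>c>0. \<forall>x\<in>space E. c \<le> W j x"
proof (induction j)
  case 0
  show ?case by (auto intro!: exI[of _ 1])
next
  case (Suc j)
  then obtain c where c: "0 < c" "\<And>x. x \<in> space E \<Longrightarrow> c \<le> W j x" by auto
  obtain x0 where x0: "x0 \<in> space E" using E_nonempty by blast
  have "(G x0 / \<delta>) * c \<le> W (Suc j) x" if x: "x \<in> space E" for x
  proof -
    have "(\<integral>y. c \<partial>M x) \<le> (\<integral>y. W j y \<partial>M x)"
      using c by (intro prob_integral_mono[OF M_prob_algebra[OF x]] W_bounded) auto
    then have "c \<le> (\<integral>y. W j y \<partial>M x)" unfolding prob_integral_const[OF M_prob_algebra[OF x]] .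
    moreover have "G x0 / \<delta> \<le> G x" using G_ratio[OF x0 x] \<delta> by (simp add: field_simps)
    ultimately show ?thesis
      using c potential_range[OF x] unfolding W.simps by (intro mult_mono) auto
  qed
  then show ?case using c potential_range[OF x0] \<delta> by (intro exI[of _ "(G x0 / \<delta>) * c"]) auto
qed

lemma W_pos: "x \<in> space E \<Longrightarrow> 0 < W j x"
  using W_lower[of j] by force

lemma integral_W_pos:
  assumes \<mu>: "\<mu> \<in> space (prob_algebra E)"
  shows "0 < (\<integral>y. W j y \<partial>\<mu>)"
proof -
  obtain c where c: "0 < c" "\<And>x. x \<in> space E \<Longrightarrow> c \<le> W j x" using W_lower[of j] by auto
  have "(\<integral>y. c \<partial>\<mu>) \<le> (\<integral>y. W j y \<partial>\<mu>)"
    using c by (intro prob_integral_mono[OF \<mu>] W_bounded) auto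
  then show ?thesis using c unfolding prob_integral_const[OF \<mu>] by simp
qed

text \<open>The starting point matters only for the first potential, at cost \<delta>, and for the
  law of the next state, at cost 1 / \<theta>. Hence the bound is the same for every
  \<open>j\<close>.\<close>

lemma W_ratio:
  assumes x: "x \<in> space E" "x' \<in> space E"
  shows "W j x \<le> \<kappa> * W j x'"
proof (cases j)
  case 0
  then show ?thesis using \<kappa> by simp
next
  case (Suc k)
  have "\<theta> * (\<integral>y. W k y \<partial>M x) \<le> (\<integral>y. W k y \<partial>M x')"
    using M_minorization[OF x(2,1) W_bounded] W_pos by (simp add: less_imp_le)
  then have "(\<integral>y. W k y \<partial>M x) \<le> (\<integral>y. W k y \<partial>M x') / \<theta>" using \<theta> by (simp add: field_simps)
  then have "G x * (\<integral>y. W k y \<partial>M x) \<le> (\<delta> * G x') * ((\<integral>y. W k y \<partial>M x') / \<theta>)"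
    using G_ratio[OF x] potential_range x \<delta> integral_W_pos[OF M_prob_algebra, of x k]
    by (intro mult_mono) (auto simp: less_imp_le)
  then show ?thesis using Suc by (simp add: \<kappa>_def)
qed

text \<open>\<open>forward_smoother a \<phi> d x\<close> is the mean of \<open>\<phi> (X\<^sub>d)\<close> under the law of the chain from \<open>x\<close>
  reweighted by the potentials up to time \<open>a + d\<close>.\<close>

primrec forward_smoother :: "nat \<Rightarrow> ('a \<Rightarrow> real) \<Rightarrow> nat \<Rightarrow> 'a \<Rightarrow> real" where
  "forward_smoother a \<phi> 0 = \<phi>"
| "forward_smoother a \<phi> (Suc d) =
    (\<lambda>x. (\<integral>y. W (a + d) y * forward_smoother a \<phi> d y \<partial>M x) / (\<integral>y. W (a + d) y \<partial>M x))"

lemma tilted_mean_bounded: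
  assumes u: "u \<in> bounded_measurable E"
  shows "(\<lambda>x. (\<integral>y. W j y * u y \<partial>M x) / (\<integral>y. W j y \<partial>M x)) \<in> bounded_measurable E"
proof -
  obtain B where B: "0 \<le> B" "\<And>x. x \<in> space E \<Longrightarrow> \<bar>u x\<bar> \<le> B" using u by (meson bounded_measurableE)
  note Wu = bounded_measurable_mult[OF W_bounded[of j] u]
  show ?thesis
  proof (rule bounded_measurableI)
    show "(\<lambda>x. (\<integral>y. W j y * u y \<partial>M x) / (\<integral>y. W j y \<partial>M x)) \<in> borel_measurable E"
      by (intro borel_measurable_divide
          bounded_measurable_measurable[OF kernel_integral_bounded_measurable[OF transition]] Wu W_bounded)
    fix x assume x: "x \<in> space E"
    note BW = bounded_measurable_mult[OF bounded_measurable_const W_bounded[of j]]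
    have "\<bar>W j y * u y\<bar> \<le> B * W j y" if "y \<in> space E" for y
      using B(2)[OF that] W_pos[OF that, of j] by (simp add: abs_mult mult.commute mult_right_mono)
    then have "(\<integral>y. W j y * u y \<partial>M x) \<le> (\<integral>y. B * W j y \<partial>M x)"
        "(\<integral>y. (- B) * W j y \<partial>M x) \<le> (\<integral>y. W j y * u y \<partial>M x)"
      by (intro prob_integral_mono[OF M_prob_algebra[OF x]] Wu BW; force simp: abs_le_iff)+
    then have "\<bar>\<integral>y. W j y * u y \<partial>M x\<bar> \<le> B * (\<integral>y. W j y \<partial>M x)" by simp
    then show "\<bar>(\<integral>y. W j y * u y \<partial>M x) / (\<integral>y. W j y \<partial>M x)\<bar> \<le> B"
      using integral_W_pos[OF M_prob_algebra[OF x], of j] by (simp add: pos_divide_le_eq)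
  qed
qed

text \<open>The minorization of \<open>M\<close> is applied to the nonnegative functions
  \<open>W j\<close>, \<open>W j * (u - lo)\<close> and \<open>W j * (hi - u)\<close>. The tilt is
  the same for both starting points, so its own variation does not enter the rate.\<close>

lemma tilted_mean_contraction:
  assumes u: "u \<in> bounded_measurable E" "band E u D"
  shows "band E (\<lambda>x. (\<integral>y. W j y * u y \<partial>M x) / (\<integral>y. W j y \<partial>M x)) (r * D)"
proof -
  obtain lo where lo: "\<And>x. x \<in> space E \<Longrightarrow> lo \<le> u x" "\<And>x. x \<in> space E \<Longrightarrow> u x \<le> lo + D"
    using u(2) unfolding band_def by blast
  obtain x0 where x0: "x0 \<in> space E" using E_nonempty by blast
  let ?A = "\<lambda>x. \<integral>y. W j y * u y \<partial>M x" and ?B = "\<lambda>x. \<integral>y. W j y \<partial>M x" and ?hi = "lo + D"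
  note Wu = bounded_measurable_mult[OF W_bounded[of j] u(1)]
  have lower_eq: "(\<integral>y. W j y * (u y - lo) \<partial>M x) = ?A x - lo * ?B x"
    and upper_eq: "(\<integral>y. W j y * (?hi - u y) \<partial>M x) = ?hi * ?B x - ?A x" if x: "x \<in> space E" for x
  proof -
    note i = integrable_bounded_measurable[OF M_prob_algebra[OF x] Wu]
      integrable_bounded_measurable[OF M_prob_algebra[OF x] W_bounded[of j]]
    have "(\<integral>y. W j y * (u y - lo) \<partial>M x) = (\<integral>y. W j y * u y - lo * W j y \<partial>M x)"
      by (simp add: algebra_simps)
    also have "\<dots> = ?A x - lo * ?B x" using i by simp
    finally show "(\<integral>y. W j y * (u y - lo) \<partial>M x) = ?A x - lo * ?B x" .
    have "(\<integral>y. W j y * (?hi - u y) \<partial>M x) = (\<integral>y. ?hi * W j y - W j y * u y \<partial>M x)"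
      by (simp add: algebra_simps)
    also have "\<dots> = ?hi * ?B x - ?A x" using i by simp
    finally show "(\<integral>y. W j y * (?hi - u y) \<partial>M x) = ?hi * ?B x - ?A x" .
  qed
  have bm: "(\<lambda>y. W j y * (u y - lo)) \<in> bounded_measurable E" "(\<lambda>y. W j y * (?hi - u y)) \<in> bounded_measurable E"
    by (intro bounded_measurable_mult bounded_measurable_diff W_bounded u(1) bounded_measurable_const)+
  have nonneg: "0 \<le> W j y * (u y - lo)" "0 \<le> W j y * (?hi - u y)" if "y \<in> space E" for y
    using W_pos[OF that, of j] lo[OF that] by auto
  have range: "lo * ?B x0 \<le> ?A x0" "?A x0 \<le> ?hi * ?B x0"
    using prob_integral_mono[OF M_prob_algebra[OF x0] bounded_measurable_const[of 0] bm(1) nonneg(1)]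
      prob_integral_mono[OF M_prob_algebra[OF x0] bounded_measurable_const[of 0] bm(2) nonneg(2)]
    by (auto simp: lower_eq[OF x0] upper_eq[OF x0])
  let ?q = "?A x0 / ?B x0"
  have "lo + \<theta>\<^sup>2 * (?q - lo) \<le> ?A x / ?B x \<and> ?A x / ?B x \<le> ?hi - \<theta>\<^sup>2 * (?hi - ?q)"
    if x: "x \<in> space E" for x
    using integral_W_pos[OF M_prob_algebra] x x0 \<theta> range
      M_minorization[OF x0 x W_bounded[of j]] W_pos[of _ j]
      M_minorization[OF x x0 bm(1) nonneg(1)] M_minorization[OF x x0 bm(2) nonneg(2)]
    unfolding lower_eq[OF x] upper_eq[OF x] lower_eq[OF x0] upper_eq[OF x0]
    by (intro conjI ratio_contraction) (auto simp: less_imp_le)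
  moreover have "?hi - \<theta>\<^sup>2 * (?hi - ?q) = lo + \<theta>\<^sup>2 * (?q - lo) + r * D"
    by (simp add: r_def algebra_simps)
  ultimately show ?thesis unfolding band_def by (intro exI[of _ "lo + \<theta>\<^sup>2 * (?q - lo)"]) auto
qed

lemma forward_smoother_bounded:
  "\<phi> \<in> bounded_measurable E \<Longrightarrow> forward_smoother a \<phi> d \<in> bounded_measurable E"
  by (induction d) (simp_all add: tilted_mean_bounded)

lemma forward_smoother_band:
  assumes "\<phi> \<in> bounded_measurable E" "band E \<phi> D"
  shows "band E (forward_smoother a \<phi> d) (r ^ d * D)"
proof (induction d)
  case (Suc d)
  then show ?case
    using tilted_mean_contraction[OF forward_smoother_bounded[OF assms(1)] Suc] by (simp add: mult.assoc)
qed (simp add: assms)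

section \<open>Contraction and duality of the empirical backward kernels\<close>

lemma backward_weight_pos: "z \<in> space E \<Longrightarrow> y \<in> space E \<Longrightarrow> 0 < G z * H z y"
  using potential_range[of z] density_pos[of z y] by simp

lemma backward_mean_bounded:
  assumes x: "x \<in> space S" and u: "u \<in> bounded_measurable E"
  shows "(\<lambda>y. weighted_mean N (\<lambda>z. G z * H z y) u x) \<in> bounded_measurable E"
proof -
  obtain B where B: "0 \<le> B" "\<And>x. x \<in> space E \<Longrightarrow> \<bar>u x\<bar> \<le> B" using u by (meson bounded_measurableE)
  show ?thesis
  proof (rule bounded_measurableI)
    show "(\<lambda>y. weighted_mean N (\<lambda>z. G z * H z y) u x) \<in> borel_measurable E"
      unfolding weighted_mean_def
      using bounded_measurable_measurable[OF H_row[OF particle_space_coord[OF x]]]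
      by (intro borel_measurable_divide borel_measurable_sum borel_measurable_times borel_measurable_const) auto
    fix y assume y: "y \<in> space E"
    have "- B \<le> weighted_mean N (\<lambda>z. G z * H z y) u x" "weighted_mean N (\<lambda>z. G z * H z y) u x \<le> B"
      using particle_space_coord[OF x] B(2) N_pos y
      by (intro weighted_mean_range[where lo = "- B" and hi = B] backward_weight_pos; force simp: abs_le_iff)+
    then show "\<bar>weighted_mean N (\<lambda>z. G z * H z y) u x\<bar> \<le> B" by (simp add: abs_le_iff)
  qed
qed

lemma backward_mean_contraction:
  assumes x: "x \<in> space S" and u: "band E u D"
  shows "band E (\<lambda>y. weighted_mean N (\<lambda>z. G z * H z y) u x) (r * D)"
proof -
  obtain lo where lo: "\<And>x. x \<in> space E \<Longrightarrow> lo \<le> u x" "\<And>x. x \<in> space E \<Longrightarrow> u x \<le> lo + D"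
    using u unfolding band_def by blast
  obtain y0 where y0: "y0 \<in> space E" using E_nonempty by blast
  let ?A = "\<lambda>y. \<Sum>i<N. G (x i) * H (x i) y * u (x i)" and ?B = "\<lambda>y. \<Sum>i<N. G (x i) * H (x i) y"
    and ?hi = "lo + D"
  have xE: "x i \<in> space E" if "i < N" for i using particle_space_coord[OF x that] .
  have pos: "0 < ?B y" if "y \<in> space E" for y
    using sum_particles_pos[OF x, of "\<lambda>z. G z * H z y"] backward_weight_pos that by auto
  have lower_eq: "?A y - lo * ?B y = (\<Sum>i<N. G (x i) * H (x i) y * (u (x i) - lo))"
    and upper_eq: "?hi * ?B y - ?A y = (\<Sum>i<N. G (x i) * H (x i) y * (?hi - u (x i)))" for y
    unfolding sum_distrib_left sum_subtractf[symmetric] by (intro sum.cong; simp add: algebra_simps)+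
  \<comment> \<open>The comparison is termwise in the particles. With \<open>g\<close> constant 1 it
    compares denominators, with the distances of \<open>u\<close> to the band edges it compares
    numerators.\<close>
  have minor: "\<theta> * (\<Sum>i<N. G (x i) * H (x i) y' * g i) \<le> (\<Sum>i<N. G (x i) * H (x i) y * g i)"
    if y: "y \<in> space E" "y' \<in> space E" and g: "\<And>i. i < N \<Longrightarrow> 0 \<le> g i" for y y' g
    unfolding sum_distrib_left
  proof (rule sum_mono)
    fix i assume "i \<in> {..<N}"
    then have i: "i < N" by simp
    have "G (x i) * g i * (\<theta> * H (x i) y') \<le> G (x i) * g i * H (x i) y"
      using H_target[OF xE[OF i] y] g[OF i] potential_range[OF xE[OF i]] by (intro mult_left_mono) auto
    then show "\<theta> * (G (x i) * H (x i) y' * g i) \<le> G (x i) * H (x i) y * g i" by (simp add: mult_ac)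
  qed
  have range: "lo * ?B y0 \<le> ?A y0" "?A y0 \<le> ?hi * ?B y0"
    using lo[OF xE] backward_weight_pos[OF xE y0] unfolding sum_distrib_left
    by (auto intro!: sum_mono simp: mult.commute[of _ "u _"] less_imp_le mult_right_mono)
  let ?q = "?A y0 / ?B y0"
  have "lo + \<theta>\<^sup>2 * (?q - lo) \<le> ?A y / ?B y \<and> ?A y / ?B y \<le> ?hi - \<theta>\<^sup>2 * (?hi - ?q)"
    if y: "y \<in> space E" for y
    using pos[OF y] pos[OF y0] \<theta> range minor[OF y0 y, of "\<lambda>_. 1"]
      minor[OF y y0, of "\<lambda>i. u (x i) - lo"] minor[OF y y0, of "\<lambda>i. ?hi - u (x i)"] lo[OF xE]
    by (intro conjI ratio_contraction) (auto simp: lower_eq upper_eq)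
  moreover have "?hi - \<theta>\<^sup>2 * (?hi - ?q) = lo + \<theta>\<^sup>2 * (?q - lo) + r * D"
    by (simp add: r_def algebra_simps)
  ultimately show ?thesis
    unfolding band_def weighted_mean_def by (intro exI[of _ "lo + \<theta>\<^sup>2 * (?q - lo)"]) auto
qed

text \<open>The duality of forward and backward transitions,
  \<open>\<eta>(dz) G(z) M(z, dy) = \<Phi>(\<eta>)(dy) \<eta>(G) M\<^bsub>\<eta>\<^esub>(y, dz)\<close> with the backward kernel on the right,
  for the empirical measure \<open>\<eta>\<close>.\<close>

lemma backward_mean_duality:
  assumes x: "x \<in> space S" and u: "u \<in> bounded_measurable E" and w: "w \<in> bounded_measurable E"
  shows "(\<Sum>i<N. G (x i) * (\<integral>y. w y * weighted_mean N (\<lambda>z. G z * H z y) u x \<partial>M (x i))) =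
    (\<Sum>i<N. G (x i) * u (x i) * (\<integral>y. w y \<partial>M (x i)))"
proof -
  let ?b = "\<lambda>y. weighted_mean N (\<lambda>z. G z * H z y) u x"
  have sp: "space lam = space E" using reference by (auto dest: sets_eq_imp_space_eq)
  have xE: "x i \<in> space E" if "i < N" for i using particle_space_coord[OF x that] .
  have wb: "(\<lambda>y. w y * ?b y) \<in> bounded_measurable E"
    by (intro bounded_measurable_mult w backward_mean_bounded x u)
  have "(\<Sum>i<N. G (x i) * (\<integral>y. w y * ?b y \<partial>M (x i))) = (\<Sum>i<N. \<integral>y. G (x i) * (H (x i) y * (w y * ?b y)) \<partial>lam)"
    by (intro sum.cong) (auto simp: integral_M[OF xE wb])
  also have "\<dots> = (\<integral>y. (\<Sum>i<N. G (x i) * (H (x i) y * (w y * ?b y))) \<partial>lam)"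
    by (intro Bochner_Integration.integral_sum[symmetric] integrable_mult_right integrable_M wb xE) simp
  also have "\<dots> = (\<integral>y. (\<Sum>i<N. (G (x i) * u (x i)) * (H (x i) y * w y)) \<partial>lam)"
  proof (intro Bochner_Integration.integral_cong refl)
    fix y assume "y \<in> space lam"
    then have "0 < (\<Sum>i<N. G (x i) * H (x i) y)"
      using sum_particles_pos[OF x, of "\<lambda>z. G z * H z y"] backward_weight_pos sp by auto
    then have b: "(\<Sum>i<N. G (x i) * H (x i) y) * ?b y = (\<Sum>i<N. G (x i) * H (x i) y * u (x i))"
      by (simp add: weighted_mean_def)
    have "(\<Sum>i<N. G (x i) * (H (x i) y * (w y * ?b y))) = w y * ((\<Sum>i<N. G (x i) * H (x i) y) * ?b y)"
      by (simp add: sum_distrib_left sum_distrib_right mult_ac)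
    also have "\<dots> = (\<Sum>i<N. (G (x i) * u (x i)) * (H (x i) y * w y))"
      unfolding b by (simp add: sum_distrib_left mult_ac)
    finally show "(\<Sum>i<N. G (x i) * (H (x i) y * (w y * ?b y))) = (\<Sum>i<N. (G (x i) * u (x i)) * (H (x i) y * w y))" .
  qed
  also have "\<dots> = (\<Sum>i<N. \<integral>y. (G (x i) * u (x i)) * (H (x i) y * w y) \<partial>lam)"
    by (intro Bochner_Integration.integral_sum integrable_mult_right integrable_M w xE) simp
  also have "\<dots> = (\<Sum>i<N. G (x i) * u (x i) * (\<integral>y. w y \<partial>M (x i)))"
    by (intro sum.cong) (auto simp: integral_M[OF xE w])
  finally show ?thesis .
qed

text \<open>Subtracting \<open>c\<close> gives the sum of \<open>W j * (u - c)\<close> over the sum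
  of \<open>W j\<close>, and hypothesis \<open>c\<close> says that the numerator has total mean
  zero. Freezing the denominator at its lower bound \<open>N * W j x0 / \<kappa>\<close> leaves a
  plain average.\<close>

lemma subgaussian_weighted_mean:
  assumes K: "\<And>i. i < N \<Longrightarrow> K i \<in> space (prob_algebra E)"
    and u: "u \<in> bounded_measurable E" "band E u D"
    and c: "(\<Sum>i<N. \<integral>y. W j y * u y \<partial>K i) = c * (\<Sum>i<N. \<integral>y. W j y \<partial>K i)"
  shows "subgaussian (Pi\<^sub>M {..<N} K) (\<lambda>y. weighted_mean N (W j) u y - c) (\<kappa>\<^sup>2 * D / sqrt N)"
proof -
  obtain lo where lo: "\<And>x. x \<in> space E \<Longrightarrow> lo \<le> u x" "\<And>x. x \<in> space E \<Longrightarrow> u x \<le> lo + D"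
    using u(2) unfolding band_def by blast
  obtain x0 where x0: "x0 \<in> space E" using E_nonempty by blast
  have D: "0 \<le> D" using lo[OF x0] by simp
  have W0: "0 < W j x0" using W_pos[OF x0] .
  have Wpos: "0 < (\<Sum>i<N. \<integral>y. W j y \<partial>K i)"
    using N_pos integral_W_pos[OF K] by (intro sum_pos) (auto simp: lessThan_empty_iff)
  have Wu: "(\<lambda>y. W j y * u y) \<in> bounded_measurable E" and cW: "(\<lambda>y. a * W j y) \<in> bounded_measurable E" for a
    by (intro bounded_measurable_mult W_bounded u bounded_measurable_const)+
  have "lo * W j y \<le> W j y * u y \<and> W j y * u y \<le> (lo + D) * W j y" if "y \<in> space E" for y
    using lo[OF that] W_pos[OF that, of j] by (simp add: mult.commute[of _ "u y"] mult_right_mono)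
  then have "(\<integral>y. lo * W j y \<partial>K i) \<le> (\<integral>y. W j y * u y \<partial>K i)"
      "(\<integral>y. W j y * u y \<partial>K i) \<le> (\<integral>y. (lo + D) * W j y \<partial>K i)" if "i < N" for i
    by (intro prob_integral_mono[OF K[OF that]] Wu cW; blast)+
  then have "lo * (\<Sum>i<N. \<integral>y. W j y \<partial>K i) \<le> (\<Sum>i<N. \<integral>y. W j y * u y \<partial>K i)"
      "(\<Sum>i<N. \<integral>y. W j y * u y \<partial>K i) \<le> (lo + D) * (\<Sum>i<N. \<integral>y. W j y \<partial>K i)"
    unfolding sum_distrib_left by (auto intro!: sum_mono)
  \<comment> \<open>Being a ratio of means with positive weights, \<open>c\<close> lies in the band
    of \<open>u\<close>; this bounds \<open>u - c\<close> by \<open>D\<close>.\<close>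
  then have c_range: "lo \<le> c" "c \<le> lo + D" using Wpos unfolding c by simp_all
  define v where "v y = \<kappa> / W j x0 * (W j y * u y - c * W j y)" for y
  have v: "v \<in> borel_measurable E"
    unfolding v_def using Wu cW
    by (intro borel_measurable_times borel_measurable_const borel_measurable_diff bounded_measurable_measurable)
  have v_le: "\<bar>v y\<bar> \<le> \<kappa>\<^sup>2 * D" if y: "y \<in> space E" for y
  proof -
    have "\<bar>u y - c\<bar> \<le> D" using lo[OF y] c_range by (simp add: abs_le_iff)
    moreover have "W j y / W j x0 \<le> \<kappa>" using W_ratio[OF y x0, of j] W0 by (simp add: field_simps)
    ultimately have "\<kappa> * ((W j y / W j x0) * \<bar>u y - c\<bar>) \<le> \<kappa> * (\<kappa> * D)"
      using \<kappa> W0 W_pos[OF y, of j] by (intro mult_mono) auto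
    moreover have "\<bar>v y\<bar> = \<kappa> * ((W j y / W j x0) * \<bar>u y - c\<bar>)"
      using \<kappa> W0 W_pos[OF y, of j] unfolding v_def
      by (simp add: abs_mult mult.commute[of c] flip: right_diff_distrib)
    ultimately show ?thesis by (simp add: power2_eq_square mult.assoc)
  qed
  have "(\<integral>y. v y \<partial>K i) = \<kappa> / W j x0 * ((\<integral>y. W j y * u y \<partial>K i) - c * (\<integral>y. W j y \<partial>K i))" if "i < N" for i
    using integrable_bounded_measurable[OF K[OF that] Wu] integrable_bounded_measurable[OF K[OF that] W_bounded[of j]]
    unfolding v_def by simp
  then have "(\<Sum>i<N. \<integral>y. v y \<partial>K i) =
      (\<Sum>i<N. \<kappa> / W j x0 * ((\<integral>y. W j y * u y \<partial>K i) - c * (\<integral>y. W j y \<partial>K i)))"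
    by (intro sum.cong) auto
  also have "\<dots> = \<kappa> / W j x0 * ((\<Sum>i<N. \<integral>y. W j y * u y \<partial>K i) - c * (\<Sum>i<N. \<integral>y. W j y \<partial>K i))"
    by (simp only: sum_distrib_left sum_subtractf right_diff_distrib)
  finally have v0: "(\<Sum>i<N. \<integral>y. v y \<partial>K i) = 0" unfolding c by simp
  have sets_K: "sets (Pi\<^sub>M {..<N} K) = sets S"
    unfolding particle_space_def using prob_algebraD[OF K] by (intro sets_PiM_cong) auto
  show ?thesis
  proof (rule subgaussian_mono[OF subgaussian_average[OF N_pos K v v_le v0]])
    show "(\<lambda>y. weighted_mean N (W j) u y - c) \<in> borel_measurable (Pi\<^sub>M {..<N} K)"
      unfolding measurable_cong_sets[OF sets_K refl]
      by (intro borel_measurable_diff measurable_weighted_mean borel_measurable_const bounded_measurable_measurable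
          W_bounded u)
    fix y assume "y \<in> space (Pi\<^sub>M {..<N} K)"
    then have yS: "y \<in> space S" using sets_eq_imp_space_eq[OF sets_K] by simp
    have yE: "y i \<in> space E" if "i < N" for i using particle_space_coord[OF yS that] .
    let ?T = "\<Sum>i<N. W j (y i)"
    have "W j x0 / \<kappa> \<le> W j (y i)" if "i < N" for i
      using W_ratio[OF x0 yE[OF that], of j] \<kappa> by (simp add: field_simps)
    then have "(\<Sum>i<N. W j x0 / \<kappa>) \<le> ?T" by (intro sum_mono) auto
    then have T: "N * W j x0 / \<kappa> \<le> ?T" by simp
    have lb: "0 < N * W j x0 / \<kappa>" using N_pos W0 \<kappa> by simp
    have T0: "0 < ?T" using T lb by linarith
    have "weighted_mean N (W j) u y - c = (\<Sum>i<N. W j (y i) * u (y i) - c * W j (y i)) / ?T"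
      using T0 by (simp add: weighted_mean_def sum_subtractf diff_divide_distrib flip: sum_distrib_left)
    then have "\<bar>weighted_mean N (W j) u y - c\<bar> = \<bar>\<Sum>i<N. W j (y i) * u (y i) - c * W j (y i)\<bar> / ?T"
      using T0 by simp
    also have "\<dots> \<le> \<bar>\<Sum>i<N. W j (y i) * u (y i) - c * W j (y i)\<bar> / (N * W j x0 / \<kappa>)"
      using T lb by (intro divide_left_mono mult_pos_pos) auto
    also have "\<dots> = \<bar>(\<kappa> / W j x0 * (\<Sum>i<N. W j (y i) * u (y i) - c * W j (y i))) / N\<bar>"
      using W0 \<kappa> by (simp add: abs_mult mult.commute)
    also have "\<kappa> / W j x0 * (\<Sum>i<N. W j (y i) * u (y i) - c * W j (y i)) = (\<Sum>i<N. v (y i))"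
      by (simp only: v_def sum_distrib_left)
    finally show "\<bar>weighted_mean N (W j) u y - c\<bar> \<le> \<bar>(\<Sum>i<N. v (y i)) / N\<bar>" .
  qed (use D in auto)
qed

end

section \<open>Telescoping along the particle paths\<close>

sublocale particle_model \<subseteq> particle: markov_kernels S "Pi\<^sub>M {..<N} (\<lambda>_. \<eta>0)" "particle_kernel E M G eps N"
  by (rule particle_markov_kernels)

context mixing_model
begin

text \<open>A function of the state at time \<open>p + d\<close> that reads only the generations
  from \<open>p\<close> to \<open>p + d - 1\<close>. It is therefore fixed before generation
  \<open>p + d\<close> is drawn.\<close>

primrec backward_smoother :: "nat \<Rightarrow> ('a \<Rightarrow> real) \<Rightarrow> (nat \<Rightarrow> nat \<Rightarrow> 'a) \<Rightarrow> nat \<Rightarrow> 'a \<Rightarrow> real" where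
  "backward_smoother p \<phi> \<xi> 0 = \<phi>"
| "backward_smoother p \<phi> \<xi> (Suc d) =
    (\<lambda>y. weighted_mean N (\<lambda>z. G z * H z y) (backward_smoother p \<phi> \<xi> d) (\<xi> (p + d)))"

lemma backward_smoother_bounded:
  assumes "\<phi> \<in> bounded_measurable E" "\<And>j. j < p + d \<Longrightarrow> \<xi> j \<in> space S"
  shows "backward_smoother p \<phi> \<xi> d \<in> bounded_measurable E"
  using assms by (induction d) (simp_all add: backward_mean_bounded)

lemma backward_smoother_band:
  assumes "band E \<phi> D" "\<And>j. j < p + d \<Longrightarrow> \<xi> j \<in> space S"
  shows "band E (backward_smoother p \<phi> \<xi> d) (r ^ d * D)"
  using assms(2)
proof (induction d)
  case (Suc d)
  have "band E (backward_smoother p \<phi> \<xi> d) (r ^ d * D)" using Suc by auto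
  then show ?case
    using backward_mean_contraction[of "\<xi> (p + d)"] Suc.prems by (simp add: mult.assoc)
qed (simp add: assms)

lemma backward_smoother_update:
  "p + d \<le> j \<Longrightarrow> backward_smoother p \<phi> (\<xi>(j := x)) d = backward_smoother p \<phi> \<xi> d"
  by (induction d) auto

lemma measurable_path_particle:
  assumes "k \<le> j" "i < N"
  shows "(\<lambda>\<xi>. \<xi> k i) \<in> particle.paths j \<rightarrow>\<^sub>M E"
  using measurable_compose[OF particle.measurable_path_coord[OF assms(1)] measurable_particle_coord[OF assms(2)]] .

lemma measurable_backward_smoother:
  assumes \<phi>: "\<phi> \<in> borel_measurable E" and d: "p + d \<le> Suc j"
  shows "(\<lambda>(\<xi>, y). backward_smoother p \<phi> \<xi> d y) \<in> borel_measurable (particle.paths j \<Otimes>\<^sub>M E)"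
  using d
proof (induction d)
  case 0
  then show ?case using measurable_compose[OF measurable_snd \<phi>] by (simp add: split_def)
next
  case (Suc d)
  have IH: "(\<lambda>z. backward_smoother p \<phi> (fst z) d (snd z)) \<in> borel_measurable (particle.paths j \<Otimes>\<^sub>M E)"
    using Suc by (simp add: split_def)
  have c: "(\<lambda>z. fst z (p + d) i) \<in> particle.paths j \<Otimes>\<^sub>M E \<rightarrow>\<^sub>M E" if "i < N" for i
    using measurable_compose[OF measurable_fst measurable_path_particle[OF _ that]] Suc.prems by simp
  have g: "(\<lambda>z. G (fst z (p + d) i)) \<in> borel_measurable (particle.paths j \<Otimes>\<^sub>M E)" if "i < N" for i
    using measurable_compose[OF c[OF that] potential_measurable] .
  have h: "(\<lambda>z. H (fst z (p + d) i) (snd z)) \<in> borel_measurable (particle.paths j \<Otimes>\<^sub>M E)" if "i < N" for i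
    using measurable_compose[OF measurable_Pair[OF c[OF that] measurable_snd] density_measurable] by simp
  have b: "(\<lambda>z. backward_smoother p \<phi> (fst z) d (fst z (p + d) i)) \<in> borel_measurable (particle.paths j \<Otimes>\<^sub>M E)"
    if "i < N" for i
    using measurable_compose[OF measurable_Pair[OF measurable_fst c[OF that]] IH] by simp
  show ?case
    unfolding backward_smoother.simps split_def weighted_mean_def
    by (intro borel_measurable_divide borel_measurable_sum borel_measurable_times g h b) auto
qed

text \<open>The function u_k of the overview. Both branches equal \<phi> at \<open>k = p\<close>,
  and neither reads generation \<open>k\<close> or a later one.\<close>

definition smoother :: "nat \<Rightarrow> nat \<Rightarrow> ('a \<Rightarrow> real) \<Rightarrow> (nat \<Rightarrow> nat \<Rightarrow> 'a) \<Rightarrow> nat \<Rightarrow> 'a \<Rightarrow> real" where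
  "smoother n p \<phi> \<xi> k = (if k \<le> p then forward_smoother (n - p) \<phi> (p - k) else backward_smoother p \<phi> \<xi> (k - p))"

lemma smoother_bounded:
  "\<phi> \<in> bounded_measurable E \<Longrightarrow> (\<And>j. j < k \<Longrightarrow> \<xi> j \<in> space S) \<Longrightarrow> smoother n p \<phi> \<xi> k \<in> bounded_measurable E"
  unfolding smoother_def by (auto intro: forward_smoother_bounded backward_smoother_bounded)

text \<open>With truncated subtraction the exponent \<open>(p - k) + (k - p)\<close> is the distance
  of \<open>k\<close> and \<open>p\<close>.\<close>

lemma smoother_band:
  assumes "\<phi> \<in> bounded_measurable E" "band E \<phi> D" "\<And>j. j < k \<Longrightarrow> \<xi> j \<in> space S"
  shows "band E (smoother n p \<phi> \<xi> k) (r ^ ((p - k) + (k - p)) * D)"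
  using forward_smoother_band[OF assms(1,2)] backward_smoother_band[OF assms(2)] assms(3)
  unfolding smoother_def by auto

lemma smoother_update: "k \<le> j \<Longrightarrow> smoother n p \<phi> (\<xi>(j := x)) k = smoother n p \<phi> \<xi> k"
  unfolding smoother_def by (auto simp: backward_smoother_update)

lemma measurable_smoother:
  assumes \<phi>: "\<phi> \<in> bounded_measurable E" and k: "k \<le> Suc j"
  shows "(\<lambda>(\<xi>, y). smoother n p \<phi> \<xi> k y) \<in> borel_measurable (particle.paths j \<Otimes>\<^sub>M E)"
proof (cases "k \<le> p")
  case True
  then show ?thesis
    using measurable_compose[OF measurable_snd bounded_measurable_measurable[OF forward_smoother_bounded[OF \<phi>]]]
    by (simp add: smoother_def split_def)
next
  case False
  then show ?thesis
    using measurable_backward_smoother[OF bounded_measurable_measurable[OF \<phi>], of p "k - p" j] k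
    by (simp add: smoother_def)
qed

text \<open>The interpolating value C_k of the overview. At \<open>k = n\<close> the weight
  \<open>W 0\<close> is 1 and a plain particle average remains.\<close>

definition estimate :: "nat \<Rightarrow> nat \<Rightarrow> ('a \<Rightarrow> real) \<Rightarrow> nat \<Rightarrow> (nat \<Rightarrow> nat \<Rightarrow> 'a) \<Rightarrow> real" where
  "estimate n p \<phi> k \<xi> = weighted_mean N (W (n - k)) (smoother n p \<phi> \<xi> k) (\<xi> k)"

text \<open>The term of the interpolation before time 0, with the exact initial law in place of the
  first generation. \<open>integral_FK_path\<close> identifies it with a mean under Q_n.\<close>

definition limit_value :: "nat \<Rightarrow> nat \<Rightarrow> ('a \<Rightarrow> real) \<Rightarrow> real" where
  "limit_value n p \<phi> = (\<integral>x. W n x * forward_smoother (n - p) \<phi> p x \<partial>\<eta>0) / (\<integral>x. W n x \<partial>\<eta>0)"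

lemma estimate_update: "k < j \<Longrightarrow> estimate n p \<phi> k (\<xi>(j := x)) = estimate n p \<phi> k \<xi>"
  unfolding estimate_def by (simp add: smoother_update)

lemma measurable_estimate:
  assumes \<phi>: "\<phi> \<in> bounded_measurable E" and k: "k \<le> j"
  shows "estimate n p \<phi> k \<in> borel_measurable (particle.paths j)"
proof -
  have m: "(\<lambda>\<xi>. \<xi> k i) \<in> particle.paths j \<rightarrow>\<^sub>M E" if "i < N" for i
    using measurable_path_particle[OF k that] .
  have s: "(\<lambda>\<xi>. smoother n p \<phi> \<xi> k (\<xi> k i)) \<in> borel_measurable (particle.paths j)" if "i < N" for i
    using measurable_compose[OF measurable_Pair[OF measurable_ident m[OF that]] measurable_smoother[OF \<phi>]] k
    by simp
  have w: "(\<lambda>\<xi>. W (n - k) (\<xi> k i)) \<in> borel_measurable (particle.paths j)" if "i < N" for i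
    using measurable_compose[OF m[OF that] bounded_measurable_measurable[OF W_bounded]] .
  show ?thesis
    unfolding estimate_def weighted_mean_def
    by (intro borel_measurable_divide borel_measurable_sum borel_measurable_times s w) auto
qed

text \<open>This supplies the centring of the next generation. Before time \<open>p\<close> the
  normaliser of the forward smoother cancels against the integral inside \<open>W (n - k)\<close>;
  from \<open>p\<close> on it is the duality of \<open>backward_mean_duality\<close>.\<close>

lemma smoother_duality:
  assumes \<phi>: "\<phi> \<in> bounded_measurable E" and k: "k < n" and \<xi>: "\<And>j. j \<le> k \<Longrightarrow> \<xi> j \<in> space S" and p: "p \<le> n"
  shows "(\<Sum>i<N. G (\<xi> k i) * (\<integral>y. W (n - Suc k) y * smoother n p \<phi> \<xi> (Suc k) y \<partial>M (\<xi> k i))) =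
    estimate n p \<phi> k \<xi> * (\<Sum>i<N. G (\<xi> k i) * (\<integral>y. W (n - Suc k) y \<partial>M (\<xi> k i)))" (is "?L = _ * ?R")
proof -
  have nk: "n - k = Suc (n - Suc k)" using k by simp
  have xE: "\<xi> k i \<in> space E" if "i < N" for i using particle_space_coord[OF \<xi>[OF order_refl] that] .
  have pos: "0 < ?R"
    using sum_particles_pos[OF \<xi>[OF order_refl], of "W (n - k)", OF W_pos] unfolding nk by simp
  have "?L = (\<Sum>i<N. W (n - k) (\<xi> k i) * smoother n p \<phi> \<xi> k (\<xi> k i))"
  proof (cases "Suc k \<le> p")
    case True
    then have "p - k = Suc (p - Suc k)" "n - p + (p - Suc k) = n - Suc k" using p by auto
    then have "smoother n p \<phi> \<xi> k x =
        (\<integral>y. W (n - Suc k) y * smoother n p \<phi> \<xi> (Suc k) y \<partial>M x) / (\<integral>y. W (n - Suc k) y \<partial>M x)" for x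
      using True by (simp add: smoother_def)
    then show ?thesis
      using integral_W_pos[OF M_prob_algebra[OF xE]] unfolding nk
      by (intro sum.cong) (auto simp: less_imp_neq[symmetric])
  next
    case False
    \<comment> \<open>The case \<open>k = p\<close> stands apart because \<open>smoother\<close>
      uses its forward branch there.\<close>
    then have b: "smoother n p \<phi> \<xi> (Suc k) = (\<lambda>y. weighted_mean N (\<lambda>z. G z * H z y) (smoother n p \<phi> \<xi> k) (\<xi> k))"
      by (cases "k = p") (auto simp: smoother_def Suc_diff_le)
    have "?L = (\<Sum>i<N. G (\<xi> k i) * smoother n p \<phi> \<xi> k (\<xi> k i) * (\<integral>y. W (n - Suc k) y \<partial>M (\<xi> k i)))"
      unfolding b by (rule backward_mean_duality[OF \<xi>[OF order_refl] smoother_bounded[OF \<phi> \<xi>] W_bounded]) simp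
    then show ?thesis unfolding nk by (simp add: mult_ac)
  qed
  also have "\<dots> = estimate n p \<phi> k \<xi> * ?R"
    using pos unfolding estimate_def weighted_mean_def nk by simp
  finally show ?thesis .
qed

definition increment :: "nat \<Rightarrow> nat \<Rightarrow> ('a \<Rightarrow> real) \<Rightarrow> nat \<Rightarrow> (nat \<Rightarrow> nat \<Rightarrow> 'a) \<Rightarrow> real" where
  "increment n p \<phi> k \<xi> = estimate n p \<phi> k \<xi> -
    (case k of 0 \<Rightarrow> limit_value n p \<phi> | Suc j \<Rightarrow> estimate n p \<phi> j \<xi>)"

lemma sum_increment: "(\<Sum>k\<le>m. increment n p \<phi> k \<xi>) = estimate n p \<phi> m \<xi> - limit_value n p \<phi>"
  by (induction m) (auto simp: increment_def)

lemma measurable_increment: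
  assumes \<phi>: "\<phi> \<in> bounded_measurable E" and k: "k \<le> j"
  shows "increment n p \<phi> k \<in> borel_measurable (particle.paths j)"
  unfolding increment_def
  using k by (cases k) (auto intro!: borel_measurable_diff measurable_estimate \<phi>)

lemma increment_update: "k < j \<Longrightarrow> increment n p \<phi> k (\<xi>(j := x)) = increment n p \<phi> k \<xi>"
  unfolding increment_def by (cases k) (auto simp: estimate_update)

lemma subgaussian_increment_local:
  assumes \<phi>: "\<phi> \<in> bounded_measurable E" "band E \<phi> D" and p: "p \<le> n" and k: "k \<le> n"
  shows "subgaussian (particle.path_law k) (increment n p \<phi> k) (\<kappa>\<^sup>2 * (r ^ ((p - k) + (k - p)) * D) / sqrt N)"
proof (cases k)
  case 0
  have u: "forward_smoother (n - p) \<phi> p \<in> bounded_measurable E"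
    "band E (forward_smoother (n - p) \<phi> p) (r ^ p * D)"
    using forward_smoother_bounded[OF \<phi>(1)] forward_smoother_band[OF \<phi>] by auto
  have "0 < (\<integral>x. W n x \<partial>\<eta>0)" by (rule integral_W_pos[OF initial_prob_algebra])
  then have "subgaussian (Pi\<^sub>M {..<N} (\<lambda>_. \<eta>0))
      (\<lambda>y. weighted_mean N (W n) (forward_smoother (n - p) \<phi> p) y - limit_value n p \<phi>) (\<kappa>\<^sup>2 * (r ^ p * D) / sqrt N)"
    by (intro subgaussian_weighted_mean u initial_prob_algebra) (auto simp: limit_value_def)
  then show ?thesis
    using measurable_increment[OF \<phi>(1) order_refl, of n p 0] unfolding 0
    by (intro particle.subgaussian_path_0) (auto simp: increment_def estimate_def smoother_def)
next
  case (Suc l)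
  show ?thesis
    unfolding Suc
  proof (rule particle.subgaussian_path_Suc)
    show "increment n p \<phi> (Suc l) \<in> borel_measurable (particle.paths (Suc l))"
      by (rule measurable_increment[OF \<phi>(1) order_refl])
    fix \<xi> assume \<xi>: "\<xi> \<in> space (particle.paths l)"
    have \<xi>S: "\<xi> j \<in> space S" if "j \<le> l" for j using particle.path_coord_space[OF \<xi> that] .
    have S: "\<xi> l \<in> space S" using \<xi>S by simp
    have xE: "\<xi> l i \<in> space E" if "i < N" for i using particle_space_coord[OF S that] .
    let ?u = "smoother n p \<phi> \<xi> (Suc l)" and ?w = "W (n - Suc l)" and ?c = "estimate n p \<phi> l \<xi>"
    let ?K = "\<lambda>i. mckean_kernel M G eps l (empirical E N (\<xi> l)) (\<xi> l i)"
    have u: "?u \<in> bounded_measurable E" "band E ?u (r ^ ((p - Suc l) + (Suc l - p)) * D)"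
      by (intro smoother_bounded[OF \<phi>(1)] smoother_band[OF \<phi>] \<xi>S; simp)+
    have wu: "(\<lambda>y. ?w y * ?u y) \<in> bounded_measurable E" by (intro bounded_measurable_mult W_bounded u)
    have l: "l < n" using k Suc by simp
    \<comment> \<open>Summing over the particles removes \<open>eps\<close>; the factor
      \<open>N\<close> and the common \<open>G\<close>-normaliser appear on both sides, and the
      duality remains.\<close>
    have "(\<Sum>i<N. \<integral>y. ?w y * ?u y \<partial>?K i) = ?c * (\<Sum>i<N. \<integral>y. ?w y \<partial>?K i)"
      unfolding sum_integral_mckean[OF S wu] sum_integral_mckean[OF S W_bounded] weighted_mean_def
      using smoother_duality[of \<phi> l n \<xi> p, OF \<phi>(1) l \<xi>S p] by simp
    then have "subgaussian (particle_kernel E M G eps N l (\<xi> l)) (\<lambda>y. weighted_mean N ?w ?u y - ?c)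
        (\<kappa>\<^sup>2 * (r ^ ((p - Suc l) + (Suc l - p)) * D) / sqrt N)"
      unfolding particle_kernel_def by (intro subgaussian_weighted_mean mckean_prob_algebra S xE u)
    \<comment> \<open>Generation \<open>Suc l\<close> enters only through the points at which the
      average is taken; the smoothed function and the previous estimate are fixed by the
      past.\<close>
    then show "subgaussian (particle_kernel E M G eps N l (\<xi> l)) (\<lambda>y. increment n p \<phi> (Suc l) (\<xi>(Suc l := y)))
        (\<kappa>\<^sup>2 * (r ^ ((p - Suc l) + (Suc l - p)) * D) / sqrt N)"
      by (simp add: increment_def estimate_update) (simp add: estimate_def smoother_update)
  qed
qed

lemma subgaussian_increment:
  assumes \<phi>: "\<phi> \<in> bounded_measurable E" "band E \<phi> D" and p: "p \<le> n" and k: "k \<le> n"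
  shows "subgaussian (particle.path_law n) (increment n p \<phi> k) (\<kappa>\<^sup>2 * (r ^ ((p - k) + (k - p)) * D) / sqrt N)"
  by (intro particle.subgaussian_path_extend[OF k] measurable_increment[OF \<phi>(1)] increment_update
      subgaussian_increment_local[OF \<phi> p k])

definition "C = 2 * \<kappa>\<^sup>2 / (1 - r)"

lemma C_pos: "0 < C"
  unfolding C_def using \<kappa> r by (intro divide_pos_pos mult_pos_pos) auto

text \<open>One geometric series for each side of \<open>p\<close>, with the term
  \<open>k = p\<close> counted twice.\<close>

lemma sum_distance_powers: "(\<Sum>k\<le>n. r ^ ((p - k) + (k - p))) \<le> 2 / (1 - r)"
proof -
  have geo: "(\<Sum>k\<le>m. r ^ k) \<le> 1 / (1 - r)" for m
    using sum_le_suminf[OF summable_geometric, of r "{..m}"] r by (simp add: suminf_geometric)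
  \<comment> \<open>Extending the range to \<open>n + p\<close> places \<open>p\<close> inside it,
    so that it splits at \<open>p\<close> without a case distinction.\<close>
  have "(\<Sum>k\<le>n. r ^ ((p - k) + (k - p))) \<le> (\<Sum>k\<le>n + p. r ^ ((p - k) + (k - p)))"
    using r by (intro sum_mono2) auto
  also have "\<dots> \<le> (\<Sum>k\<in>{..p} \<union> {p..n + p}. r ^ ((p - k) + (k - p)))"
    using r by (intro sum_mono2) auto
  also have "\<dots> \<le> (\<Sum>k\<le>p. r ^ ((p - k) + (k - p))) + (\<Sum>k=p..n + p. r ^ ((p - k) + (k - p)))"
    using r sum.union_inter[of "{..p}" "{p..n + p}" "\<lambda>k. r ^ ((p - k) + (k - p))"]
      sum_nonneg[of "{..p} \<inter> {p..n + p}" "\<lambda>k. r ^ ((p - k) + (k - p))"] by simp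
  also have "(\<Sum>k\<le>p. r ^ ((p - k) + (k - p))) = (\<Sum>k\<le>p. r ^ k)"
    by (rule sum.reindex_bij_witness[of _ "\<lambda>k. p - k" "\<lambda>k. p - k"]) auto
  also have "(\<Sum>k=p..n + p. r ^ ((p - k) + (k - p))) = (\<Sum>k\<le>n. r ^ k)"
    by (rule sum.reindex_bij_witness[of _ "\<lambda>k. k + p" "\<lambda>k. k - p"]) auto
  finally show ?thesis using geo[of p] geo[of n] by simp
qed

lemma subgaussian_estimate:
  assumes \<phi>: "\<phi> \<in> bounded_measurable E" "band E \<phi> 1" and p: "p \<le> n"
  shows "subgaussian (particle.path_law n) (\<lambda>\<xi>. estimate n p \<phi> n \<xi> - limit_value n p \<phi>) (C / sqrt N)"
proof -
  let ?\<sigma> = "\<lambda>k. \<kappa>\<^sup>2 * (r ^ ((p - k) + (k - p)) * 1) / sqrt N"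
  have \<sigma>: "0 < ?\<sigma> k" for k using r \<kappa> N_pos by simp
  have "subgaussian (particle.path_law n) (\<lambda>\<xi>. \<Sum>k\<le>n. increment n p \<phi> k \<xi>) (\<Sum>k\<le>n. ?\<sigma> k)"
    by (intro subgaussian_sum subgaussian_increment[OF \<phi> p] \<sigma>) auto
  then have sg: "subgaussian (particle.path_law n) (\<lambda>\<xi>. estimate n p \<phi> n \<xi> - limit_value n p \<phi>) (\<Sum>k\<le>n. ?\<sigma> k)"
    unfolding sum_increment .
  have "(\<Sum>k\<le>n. ?\<sigma> k) = \<kappa>\<^sup>2 / sqrt N * (\<Sum>k\<le>n. r ^ ((p - k) + (k - p)))"
    by (simp add: sum_distrib_left)
  also have "\<dots> \<le> \<kappa>\<^sup>2 / sqrt N * (2 / (1 - r))"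
    by (intro mult_left_mono sum_distance_powers) simp
  finally have "(\<Sum>k\<le>n. ?\<sigma> k) \<le> C / sqrt N" by (simp add: C_def mult_ac)
  then show ?thesis
    by (intro subgaussian_mono[OF sg subgaussian_measurable[OF sg]] sum_nonneg less_imp_le[OF \<sigma>] order_refl)
qed

end

section \<open>Identification of the path measures\<close>

lemma (in markov_kernels) integral_path_marginal:
  assumes \<phi>: "\<phi> \<in> bounded_measurable S" and j: "j \<le> n"
  shows "(\<integral>w. \<phi> (w j) \<partial>path_law n) = (\<integral>w. \<phi> (w j) \<partial>path_law j)"
  using j
proof (induction n rule: dec_induct)
  case (step n)
  have "(\<lambda>w. \<phi> (w j)) \<in> bounded_measurable (paths k)" if "j \<le> k" for k
    using bounded_measurable_comp[OF \<phi> measurable_path_coord[OF that]] .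
  then have "(\<integral>w. \<phi> (w j) * 1 \<partial>path_law (Suc n)) = (\<integral>w. \<phi> (w j) * (\<integral>x. 1 \<partial>K n (w n)) \<partial>path_law n)"
    using step by (intro integral_path_product[where \<phi> = "\<lambda>_. 1"]) auto
  also have "\<dots> = (\<integral>w. \<phi> (w j) \<partial>path_law n)"
    using prob_algebraD[OF path_prob[of n]]
    by (intro Bochner_Integration.integral_cong refl) (simp add: prob_space.prob_space[OF prob_algebraD(1)[OF K_path]])
  finally show ?case using step.IH by simp
qed simp

sublocale feynman_kac_model \<subseteq> chain: markov_kernels E \<eta>0 "\<lambda>_. M"
  using initial transition by unfold_locales (auto simp: space_prob_algebra)

context mixing_model
begin

section \<open>Marginals of the Feynman-Kac path measure\<close>

lemma path_product_bounded:
  assumes "k \<le> Suc j"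
  shows "(\<lambda>w. \<Prod>q<k. G (w q)) \<in> bounded_measurable (chain.paths j)"
  using assms
  by (intro bounded_measurable_prod bounded_measurable_comp[OF G_bounded] chain.measurable_path_coord) auto

lemma path_product_update: "(\<Prod>q<Suc k. G ((w(Suc k := x)) q)) = (\<Prod>q<Suc k. G (w q))"
  by (intro prod.cong) auto

text \<open>Downward induction from \<open>k = n\<close>, where \<open>W 0\<close> is 1. Integrating
  out the last state and taking one potential from the product turns \<open>W (n - Suc k)\<close>
  into \<open>W (n - k)\<close>.\<close>

lemma integral_chain_after:
  assumes \<phi>: "\<phi> \<in> bounded_measurable E" and k: "p \<le> k" "k \<le> n"
  shows "(\<integral>w. (\<phi> (w p) * (\<Prod>q<k. G (w q))) * W (n - k) (w k) \<partial>chain.path_law k) =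
    (\<integral>w. \<phi> (w p) * (\<Prod>q<n. G (w q)) \<partial>chain.path_law n)"
  using k(2,1)
proof (induction k rule: inc_induct)
  case (step k)
  let ?F = "\<lambda>w. \<phi> (w p) * (\<Prod>q<Suc k. G (w q))"
  have nk: "n - k = Suc (n - Suc k)" using step by simp
  have upd: "?F (w(Suc k := x)) = ?F w" for w x unfolding path_product_update using step.prems by simp
  have "(\<integral>w. ?F w * W (n - Suc k) (w (Suc k)) \<partial>chain.path_law (Suc k)) =
      (\<integral>w. ?F w * (\<integral>x. W (n - Suc k) x \<partial>M (w k)) \<partial>chain.path_law k)"
    using step.prems upd
    by (intro chain.integral_path_product bounded_measurable_mult bounded_measurable_comp[OF \<phi>]
        path_product_bounded chain.measurable_path_coord W_bounded) auto
  also have "\<dots> = (\<integral>w. (\<phi> (w p) * (\<Prod>q<k. G (w q))) * W (n - k) (w k) \<partial>chain.path_law k)"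
    unfolding nk by (simp add: mult_ac)
  finally show ?case using step by simp
qed simp

text \<open>The same induction continued below \<open>p\<close>. The denominator of the forward
  smoother cancels against \<open>W\<close>, and at \<open>k = 0\<close> the numerator of
  \<open>limit_value\<close> appears.\<close>

lemma integral_chain_before:
  assumes \<phi>: "\<phi> \<in> bounded_measurable E" and k: "k \<le> p" "p \<le> n"
  shows "(\<integral>w. (\<Prod>q<k. G (w q)) * (W (n - k) (w k) * forward_smoother (n - p) \<phi> (p - k) (w k)) \<partial>chain.path_law k) =
    (\<integral>w. \<phi> (w p) * (\<Prod>q<n. G (w q)) \<partial>chain.path_law n)"
  using k(1)
proof (induction k rule: inc_induct)
  case base
  show ?case using integral_chain_after[OF \<phi> order_refl k(2)] by (simp add: mult_ac)
next
  case (step k)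
  let ?g = "\<lambda>x. W (n - Suc k) x * forward_smoother (n - p) \<phi> (p - Suc k) x"
  have e: "n - k = Suc (n - Suc k)" "p - k = Suc (p - Suc k)" "n - p + (p - Suc k) = n - Suc k"
    using step k by auto
  have "(\<integral>w. (\<Prod>q<Suc k. G (w q)) * ?g (w (Suc k)) \<partial>chain.path_law (Suc k)) =
      (\<integral>w. (\<Prod>q<Suc k. G (w q)) * (\<integral>x. ?g x \<partial>M (w k)) \<partial>chain.path_law k)"
    by (intro chain.integral_path_product path_product_bounded bounded_measurable_mult W_bounded
        forward_smoother_bounded \<phi> path_product_update) auto
  also have "\<dots> = (\<integral>w. (\<Prod>q<k. G (w q)) * (W (n - k) (w k) * forward_smoother (n - p) \<phi> (p - k) (w k)) \<partial>chain.path_law k)"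
  proof (intro Bochner_Integration.integral_cong refl)
    fix w assume "w \<in> space (chain.path_law k)"
    then have "w k \<in> space E"
      using prob_algebraD[OF chain.path_prob[of k]] chain.path_coord_space[of w k k] by simp
    then have "0 < (\<integral>y. W (n - Suc k) y \<partial>M (w k))" by (intro integral_W_pos M_prob_algebra)
    then show "(\<Prod>q<Suc k. G (w q)) * (\<integral>x. ?g x \<partial>M (w k)) =
        (\<Prod>q<k. G (w q)) * (W (n - k) (w k) * forward_smoother (n - p) \<phi> (p - k) (w k))"
      unfolding e(1,2) W.simps forward_smoother.simps e(3) by simp
  qed
  finally show ?case using step by simp
qed

lemma integral_chain_weight: "(\<integral>w. (\<Prod>q<n. G (w q)) \<partial>chain.path_law n) = (\<integral>x. W n x \<partial>\<eta>0)"
  using integral_chain_after[of "\<lambda>_. 1" 0 0 n] chain.integral_path_0[OF W_bounded[of n]] by simp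

lemma chain_weight:
  shows "(\<lambda>w. \<Prod>q<n. G (w q)) \<in> bounded_measurable (chain.paths n)"
    and "w \<in> space (chain.paths n) \<Longrightarrow> 0 \<le> (\<Prod>q<n. G (w q))"
    and "0 < (\<integral>w. (\<Prod>q<n. G (w q)) \<partial>chain.path_law n)"
proof -
  show "(\<lambda>w. \<Prod>q<n. G (w q)) \<in> bounded_measurable (chain.paths n)" by (simp add: path_product_bounded)
  show "0 \<le> (\<Prod>q<n. G (w q))" if "w \<in> space (chain.paths n)"
    using potential_range chain.path_coord_space[OF that] by (intro prod_nonneg) (auto simp: less_imp_le)
  show "0 < (\<integral>w. (\<Prod>q<n. G (w q)) \<partial>chain.path_law n)"
    unfolding integral_chain_weight by (rule integral_W_pos[OF initial_prob_algebra])
qed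

lemma integral_FK_path:
  assumes \<phi>: "\<phi> \<in> bounded_measurable E" and p: "p \<le> n"
  shows "(\<integral>w. \<phi> (w p) \<partial>FK_path E \<eta>0 M G n) = limit_value n p \<phi>"
proof -
  have "(\<lambda>w. \<phi> (w p)) \<in> bounded_measurable (chain.paths n)"
    by (rule bounded_measurable_comp[OF \<phi> chain.measurable_path_coord[OF p]])
  then have "(\<integral>w. \<phi> (w p) \<partial>FK_path E \<eta>0 M G n) =
      (\<integral>w. \<phi> (w p) * (\<Prod>q<n. G (w q)) \<partial>chain.path_law n) / (\<integral>x. W n x \<partial>\<eta>0)"
    unfolding FK_path_def integral_chain_weight[symmetric]
    by (subst integral_boltzmann[OF chain.path_prob chain_weight]) (auto simp: mult.commute)
  also have "\<dots> = limit_value n p \<phi>"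
    using integral_chain_before[OF \<phi> _ p, of 0]
      chain.integral_path_0[OF bounded_measurable_mult[OF W_bounded forward_smoother_bounded[OF \<phi>]], of n "n - p" p]
    by (simp add: limit_value_def)
  finally show ?thesis .
qed

section \<open>The particle path measure as a reversed chain\<close>

lemma
  assumes x: "x \<in> space S"
  shows backward_kernel_measurable: "backward_kernel G H (empirical E N x) \<in> E \<rightarrow>\<^sub>M prob_algebra E"
    and integral_backward_kernel: "y \<in> space E \<Longrightarrow> \<phi> \<in> bounded_measurable E \<Longrightarrow>
      (\<integral>z. \<phi> z \<partial>backward_kernel G H (empirical E N x) y) = weighted_mean N (\<lambda>z. G z * H z y) \<phi> x"
proof -
  note emp = empirical_prob_algebra[OF N_pos x]
  have gh: "(\<lambda>z. G z * H z y) \<in> bounded_measurable E" if "y \<in> space E" for y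
    by (intro bounded_measurable_mult G_bounded H_col that)
  have pos: "0 < (\<integral>z. G z * H z y \<partial>empirical E N x)" if "y \<in> space E" for y
    using sum_particles_pos[OF x, of "\<lambda>z. G z * H z y"] backward_weight_pos that N_pos
    by (subst integral_empirical[OF N_pos x bounded_measurable_measurable[OF gh[OF that]]]) auto
  have nonneg: "0 \<le> G z * H z y" if "y \<in> space E" "z \<in> space E" for y z
    using backward_weight_pos[OF that(2,1)] by simp
  show int: "(\<integral>z. \<phi> z \<partial>backward_kernel G H (empirical E N x) y) = weighted_mean N (\<lambda>z. G z * H z y) \<phi> x"
    if y: "y \<in> space E" and \<phi>: "\<phi> \<in> bounded_measurable E" for y \<phi>
  proof -
    have "(\<integral>z. \<phi> z \<partial>backward_kernel G H (empirical E N x) y) =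
        (\<integral>z. G z * H z y * \<phi> z \<partial>empirical E N x) / (\<integral>z. G z * H z y \<partial>empirical E N x)"
      unfolding backward_kernel_def by (rule integral_boltzmann[OF emp gh[OF y] nonneg[OF y] pos[OF y] \<phi>])
    then show ?thesis
      using N_pos bounded_measurable_measurable[OF bounded_measurable_mult[OF gh[OF y] \<phi>]]
      by (simp add: integral_empirical[OF N_pos x] bounded_measurable_measurable[OF gh[OF y]] weighted_mean_def)
  qed
  show "backward_kernel G H (empirical E N x) \<in> E \<rightarrow>\<^sub>M prob_algebra E"
  proof (rule measurable_prob_algebra_integralI)
    show "backward_kernel G H (empirical E N x) y \<in> space (prob_algebra E)" if "y \<in> space E" for y
      unfolding backward_kernel_def
      by (rule boltzmann_prob_algebra[OF emp gh[OF that] nonneg[OF that] pos[OF that]])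
    fix A assume "A \<in> sets E"
    note A = bounded_measurable_indicator[OF this]
    show "(\<lambda>y. \<integral>z. indicat_real A z \<partial>backward_kernel G H (empirical E N x) y) \<in> borel_measurable E"
      using bounded_measurable_measurable[OF backward_mean_bounded[OF x A]]
      by (subst measurable_cong[OF int[OF _ A]])
  qed
qed

text \<open>On the reversed clock time \<open>p\<close> is reached after \<open>n - p\<close> steps.
  Integrating out the kernels from there back to the initial law at time \<open>n\<close> builds the
  backward smoother one generation at a time.\<close>

lemma integral_FK_path_approx:
  assumes \<phi>: "\<And>p. p \<le> n \<Longrightarrow> \<phi> p \<in> bounded_measurable E" and \<xi>: "\<And>k. k \<le> n \<Longrightarrow> \<xi> k \<in> space S"
  shows "(\<integral>w. (\<Sum>p\<le>n. \<phi> p (w p)) \<partial>FK_path_approx E G H N n \<xi>) = (\<Sum>p\<le>n. estimate n p (\<phi> p) n \<xi>)"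
proof -
  let ?K = "\<lambda>k. backward_kernel G H (empirical E N (\<xi> (n - k - 1)))"
  interpret bwd: markov_kernels E "empirical E N (\<xi> n)" "?K"
    by unfold_locales (auto intro!: backward_kernel_measurable empirical_prob_algebra N_pos \<xi>)
  have marginal: "(\<integral>w. \<phi> p (w (n - p)) \<partial>bwd.path_law n) = estimate n p (\<phi> p) n \<xi>" if p: "p \<le> n" for p
  proof -
    let ?b = "backward_smoother p (\<phi> p) \<xi>"
    have b: "?b d \<in> bounded_measurable E" if "d \<le> n - p" for d
      using that p by (intro backward_smoother_bounded \<phi> \<xi>) auto
    have "(\<integral>w. \<phi> p (w (n - p)) \<partial>bwd.path_law (n - p)) = (\<integral>w. ?b d (w (n - p - d)) \<partial>bwd.path_law (n - p - d))"
      if "d \<le> n - p" for d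
      using that
    proof (induction d)
      case (Suc d)
      let ?k = "n - p - Suc d"
      \<comment> \<open>Step \<open>?k\<close> of the reversed chain uses generation
        \<open>p + d\<close>, the one over which the next smoothing step averages.\<close>
      have k: "n - p - d = Suc ?k" "n - ?k - 1 = p + d" using Suc p by auto
      have "(\<integral>w. \<phi> p (w (n - p)) \<partial>bwd.path_law (n - p)) = (\<integral>w. ?b d (w (n - p - d)) \<partial>bwd.path_law (n - p - d))"
        using Suc.prems by (intro Suc.IH) simp
      also have "\<dots> = (\<integral>w. 1 * ?b d (w (Suc ?k)) \<partial>bwd.path_law (Suc ?k))"
        unfolding k(1) mult_1 ..
      also have "\<dots> = (\<integral>w. 1 * (\<integral>x. ?b d x \<partial>?K ?k (w ?k)) \<partial>bwd.path_law ?k)"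
        using Suc.prems by (intro bwd.integral_path_product b) auto
      also have "\<dots> = (\<integral>w. ?b (Suc d) (w ?k) \<partial>bwd.path_law ?k)"
      proof (intro Bochner_Integration.integral_cong refl)
        fix w assume "w \<in> space (bwd.path_law ?k)"
        then have w: "w ?k \<in> space E"
          using prob_algebraD[OF bwd.path_prob[of ?k]] bwd.path_coord_space[of w ?k ?k] by simp
        have "\<xi> (p + d) \<in> space S" "?b d \<in> bounded_measurable E" using Suc.prems p by (auto intro: \<xi> b)
        then show "1 * (\<integral>x. ?b d x \<partial>?K ?k (w ?k)) = ?b (Suc d) (w ?k)"
          unfolding k(2) using integral_backward_kernel[OF _ w] by simp
      qed
      finally show ?case .
    qed simp
    from this[OF order_refl]
    have "(\<integral>w. \<phi> p (w (n - p)) \<partial>bwd.path_law (n - p)) = (\<integral>w. ?b (n - p) (w 0) \<partial>bwd.path_law 0)" by simp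
    also have "\<dots> = (\<Sum>i<N. ?b (n - p) (\<xi> n i)) / N"
      using bwd.integral_path_0[OF b[OF order_refl]]
      by (simp add: integral_empirical[OF N_pos \<xi>[OF order_refl] bounded_measurable_measurable[OF b[OF order_refl]]])
    also have "\<dots> = estimate n p (\<phi> p) n \<xi>"
      using p by (cases "n = p") (auto simp: estimate_def smoother_def weighted_mean_def)
    finally show ?thesis
      using bwd.integral_path_marginal[OF \<phi>[OF p], of "n - p" n] by simp
  qed
  have rev: "(\<lambda>w. \<lambda>p\<in>{..n}. w (n - p)) \<in> bwd.path_law n \<rightarrow>\<^sub>M bwd.paths n"
    unfolding measurable_cong_sets[OF prob_algebraD(2)[OF bwd.path_prob] refl]
    by (intro measurable_restrict bwd.measurable_path_coord) simp
  have "(\<lambda>w. \<Sum>p\<le>n. \<phi> p (w p)) \<in> bounded_measurable (bwd.paths n)"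
    by (intro bounded_measurable_sum bounded_measurable_comp[OF \<phi>] bwd.measurable_path_coord) auto
  note m = bounded_measurable_measurable[OF this]
  have "(\<integral>w. (\<Sum>p\<le>n. \<phi> p (w p)) \<partial>FK_path_approx E G H N n \<xi>) =
      (\<integral>w. (\<Sum>p\<le>n. \<phi> p ((\<lambda>p\<in>{..n}. w (n - p)) p)) \<partial>bwd.path_law n)"
    unfolding FK_path_approx_def backward_path_def by (rule integral_distr[OF rev m])
  also have "\<dots> = (\<integral>w. (\<Sum>p\<le>n. \<phi> p (w (n - p))) \<partial>bwd.path_law n)"
    by (intro Bochner_Integration.integral_cong refl sum.cong) auto
  also have "\<dots> = (\<Sum>p\<le>n. \<integral>w. \<phi> p (w (n - p)) \<partial>bwd.path_law n)"
    by (intro Bochner_Integration.integral_sum integrable_bounded_measurable[OF bwd.path_prob]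
        bounded_measurable_comp[OF \<phi>] bwd.measurable_path_coord) auto
  also have "\<dots> = (\<Sum>p\<le>n. estimate n p (\<phi> p) n \<xi>)"
    by (intro sum.cong refl marginal) auto
  finally show ?thesis .
qed

lemma integral_additive_FK_path:
  assumes \<phi>: "\<And>p. \<phi> p \<in> bounded_measurable E"
  shows "(\<integral>w. additive_mean \<phi> n w \<partial>FK_path E \<eta>0 M G n) = (1 / real (n + 1)) * (\<Sum>p\<le>n. limit_value n p (\<phi> p))"
proof -
  have P: "FK_path E \<eta>0 M G n \<in> space (prob_algebra (chain.paths n))"
    unfolding FK_path_def by (rule boltzmann_prob_algebra[OF chain.path_prob chain_weight])
  have "(\<integral>w. (\<Sum>p\<le>n. \<phi> p (w p)) \<partial>FK_path E \<eta>0 M G n) = (\<Sum>p\<le>n. \<integral>w. \<phi> p (w p) \<partial>FK_path E \<eta>0 M G n)"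
    by (intro Bochner_Integration.integral_sum integrable_bounded_measurable[OF P]
        bounded_measurable_comp[OF \<phi>] chain.measurable_path_coord) auto
  also have "\<dots> = (\<Sum>p\<le>n. limit_value n p (\<phi> p))"
    by (intro sum.cong refl integral_FK_path \<phi>) auto
  finally show ?thesis unfolding additive_mean_def by simp
qed

text \<open>The \<open>n + 1\<close> errors share one scale. Their sum has \<open>n + 1\<close>
  times that scale, however they are correlated, and the division by \<open>n + 1\<close> restores
  it.\<close>

lemma subgaussian_additive_error:
  assumes \<phi>: "\<And>p. \<phi> p \<in> bounded_measurable E" and band: "\<And>p. band E (\<phi> p) 1"
  shows "subgaussian (particle_law E \<eta>0 M G eps N n)
    (\<lambda>\<xi>. (\<integral>w. additive_mean \<phi> n w \<partial>FK_path_approx E G H N n \<xi>) - (\<integral>w. additive_mean \<phi> n w \<partial>FK_path E \<eta>0 M G n))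
    (C / sqrt N)"
proof -
  let ?X = "\<lambda>\<xi>. (1 / real (n + 1)) * (\<Sum>p\<le>n. estimate n p (\<phi> p) n \<xi> - limit_value n p (\<phi> p))"
  have law: "particle_law E \<eta>0 M G eps N n = particle.path_law n"
    by (simp add: particle_law_def)
  have eq: "(\<integral>w. additive_mean \<phi> n w \<partial>FK_path_approx E G H N n \<xi>) - (\<integral>w. additive_mean \<phi> n w \<partial>FK_path E \<eta>0 M G n) = ?X \<xi>"
    if "\<xi> \<in> space (particle.path_law n)" for \<xi>
  proof -
    have "\<xi> k \<in> space S" if "k \<le> n" for k
      using \<open>\<xi> \<in> space (particle.path_law n)\<close> particle.path_coord_space[OF _ that]
        prob_algebraD[OF particle.path_prob[of n]] by simp
    from integral_FK_path_approx[OF \<phi> this]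
    have "(\<integral>w. additive_mean \<phi> n w \<partial>FK_path_approx E G H N n \<xi>) = (1 / real (n + 1)) * (\<Sum>p\<le>n. estimate n p (\<phi> p) n \<xi>)"
      unfolding additive_mean_def by simp
    then show ?thesis
      unfolding integral_additive_FK_path[OF \<phi>] by (simp add: sum_subtractf diff_divide_distrib)
  qed
  have "0 < C / sqrt N" using C_pos N_pos by simp
  then have "subgaussian (particle.path_law n) (\<lambda>\<xi>. \<Sum>p\<le>n. estimate n p (\<phi> p) n \<xi> - limit_value n p (\<phi> p)) (\<Sum>p\<le>n. C / sqrt N)"
    by (intro subgaussian_sum subgaussian_estimate \<phi> band) auto
  then have "subgaussian (particle.path_law n) ?X ((1 / real (n + 1)) * (\<Sum>p\<le>n. C / sqrt N))"
    by (rule subgaussian_scale) simp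
  also have "(1 / real (n + 1)) * (\<Sum>p\<le>n. C / sqrt N) = C / sqrt N" by simp
  finally have X: "subgaussian (particle.path_law n) ?X (C / sqrt N)" .
  show ?thesis
    unfolding law
  proof (rule subgaussian_mono[OF X])
    show "(\<lambda>\<xi>. (\<integral>w. additive_mean \<phi> n w \<partial>FK_path_approx E G H N n \<xi>) - (\<integral>w. additive_mean \<phi> n w \<partial>FK_path E \<eta>0 M G n))
        \<in> borel_measurable (particle.path_law n)"
      using subgaussian_measurable[OF X] by (subst measurable_cong[OF eq])
  qed (use eq C_pos in auto)
qed

end

section \<open>The concentration inequality\<close>

lemma Osc1_bounded_band:
  assumes f: "f \<in> Osc1 E" and E: "space E \<noteq> {}"
  shows "f \<in> bounded_measurable E" "band E f 1"
proof -
  have osc: "f x - f y \<le> 1" if "x \<in> space E" "y \<in> space E" for x y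
  proof -
    have "ereal \<bar>f x - f y\<bar> \<le> osc E f"
      unfolding osc_def using that by (intro SUP_upper2[of "(x, y)"]) auto
    also have "\<dots> \<le> 1" using f by (simp add: Osc1_def)
    finally show ?thesis by (simp add: one_ereal_def)
  qed
  obtain x0 where x0: "x0 \<in> space E" using E by auto
  show "f \<in> bounded_measurable E"
  proof (rule bounded_measurableI)
    show "f \<in> borel_measurable E" using f by (simp add: Osc1_def)
    show "\<bar>f x\<bar> \<le> \<bar>f x0\<bar> + 1" if "x \<in> space E" for x
      using osc[OF that x0] osc[OF x0 that] by linarith
  qed
  have bdd: "bdd_below (f ` space E)"
    using osc[OF x0] by (intro bdd_belowI2[of _ "f x0 - 1"]) (simp add: algebra_simps)
  show "band E f 1"
    unfolding band_def
  proof (intro exI[of _ "INF x\<in>space E. f x"] ballI conjI)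
    fix x assume x: "x \<in> space E"
    show "(INF x\<in>space E. f x) \<le> f x" by (rule cINF_lower[OF bdd x])
    have "f x - 1 \<le> (INF x\<in>space E. f x)"
      using osc[OF x] by (intro cINF_greatest E) (simp add: algebra_simps)
    then show "f x \<le> (INF x\<in>space E. f x) + 1" by simp
  qed
qed

text \<open>As \<open>H x\<close> integrates to \<open>1\<close>, comparability of \<open>H\<close> in the target variable implies comparability
  in the source variable. Hence one step of \<open>M\<close> already mixes.\<close>

lemma (in feynman_kac_model) density_source_comparable:
  assumes h: "0 < h" and H: "\<And>x y y'. x \<in> space E \<Longrightarrow> y \<in> space E \<Longrightarrow> y' \<in> space E \<Longrightarrow> h * H x y' \<le> H x y"
    and x: "x \<in> space E" "x' \<in> space E" and y: "y \<in> space E"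
  shows "h\<^sup>2 * H x' y \<le> H x y"
proof -
  have sp: "space lam = space E" using reference by (auto dest: sets_eq_imp_space_eq)
  have m: "(\<lambda>z. ennreal (H x z)) \<in> borel_measurable lam" if "x \<in> space E" for x
  proof -
    have "H x \<in> borel_measurable E"
      using measurable_compose[OF measurable_Pair1'[OF that] density_measurable] by simp
    then show ?thesis using reference(2) by (simp cong: measurable_cong_sets)
  qed
  have one: "(\<integral>\<^sup>+z. ennreal (H x z) \<partial>lam) = 1" if x: "x \<in> space E" for x
  proof -
    interpret prob_space "M x" using prob_algebra_kernelD(1)[OF transition x] .
    have "(\<integral>\<^sup>+z. ennreal (H x z) \<partial>lam) = emeasure (M x) (space (M x))"
      unfolding transition_density[OF x] using m[OF x]
      by (simp add: emeasure_density cong: nn_integral_cong)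
    then show ?thesis by (simp add: emeasure_space_1)
  qed
  have "ennreal (h\<^sup>2 * H x' y) = (\<integral>\<^sup>+z. ennreal (h\<^sup>2 * H x' y) * ennreal (H x z) \<partial>lam)"
    using m[OF x(1)] by (simp add: nn_integral_cmult one[OF x(1)])
  also have "\<dots> \<le> (\<integral>\<^sup>+z. ennreal (H x y) * ennreal (H x' z) \<partial>lam)"
  proof (rule nn_integral_mono)
    fix z assume "z \<in> space lam"
    then have z: "z \<in> space E" by (simp add: sp)
    \<comment> \<open>Two comparisons in the target are multiplied, from \<open>z\<close> to
      \<open>y\<close> in the row of \<open>x\<close> and from \<open>y\<close> to \<open>z\<close>
      in the row of \<open>x'\<close>. Integrating over \<open>z\<close> removes both factors that
      depend on it.\<close>
    have "(h * H x z) * (h * H x' y) \<le> H x y * H x' z"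
      using h density_pos x y z by (intro mult_mono H) (auto simp: less_imp_le)
    then have "(h\<^sup>2 * H x' y) * H x z \<le> H x y * H x' z" by (simp add: power2_eq_square mult_ac)
    then have "ennreal ((h\<^sup>2 * H x' y) * H x z) \<le> ennreal (H x y * H x' z)" by (rule ennreal_leI)
    then show "ennreal (h\<^sup>2 * H x' y) * ennreal (H x z) \<le> ennreal (H x y) * ennreal (H x' z)"
      using h density_pos[OF x(1) z] density_pos[OF x(1) y] density_pos[OF x(2) y] density_pos[OF x(2) z]
      by (simp add: ennreal_mult less_imp_le)
  qed
  also have "\<dots> = ennreal (H x y)"
    using m[OF x(2)] by (simp add: nn_integral_cmult one[OF x(2)])
  finally show ?thesis using density_pos[OF x(1) y] by (simp add: ennreal_le_iff)
qed

lemma eln_le: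
  assumes "p \<le> exp a" and c: "0 < c"
  shows "ereal c * eln p \<le> ereal (c * a)"
proof (cases "p \<le> 0")
  case True
  then show ?thesis using c by (simp add: eln_def)
next
  case False
  then have "ln p \<le> a" using assms(1) ln_le_cancel_iff[of p "exp a"] by simp
  then show ?thesis using False c by (simp add: eln_def)
qed

theorem mainTheorem4:
  fixes E \<eta>0 lam :: "'a measure" and M :: "'a \<Rightarrow> 'a measure"
    and G :: "'a \<Rightarrow> real" and H :: "'a \<Rightarrow> 'a \<Rightarrow> real"
    and eps :: "nat \<Rightarrow> real" and f :: "nat \<Rightarrow> 'a \<Rightarrow> real"
    and m :: nat and \<delta> \<rho> :: real
  assumes model: "feynman_kac_model E \<eta>0 M G H lam"
    and eps: "\<And>n. 0 \<le> eps n" "\<And>n x. x \<in> space E \<Longrightarrow> eps n * G x \<le> 1"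
    and params: "1 \<le> m" "1 \<le> \<delta>" "1 \<le> \<rho>"
    and G_mixing: "\<And>x x'. x \<in> space E \<Longrightarrow> x' \<in> space E \<Longrightarrow> G x \<le> \<delta> * G x'"
    and M_mixing: "\<And>x x' A. x \<in> space E \<Longrightarrow> x' \<in> space E \<Longrightarrow> A \<in> sets E \<Longrightarrow>
        emeasure (kernel_pow E M m x) A \<le> ennreal \<rho> * emeasure (kernel_pow E M m x') A"
    and H_ratio: "0 < (INF (x, y, y') \<in> space E \<times> space E \<times> space E. H x y / H x y')"
    and f: "\<And>p. f p \<in> Osc1 E"
  shows "\<exists>b>0. \<forall>\<epsilon>>0. \<forall>N\<ge>1.
    ereal (1 / real N) * eln (SUP n. \<P>(\<xi> in particle_law E \<eta>0 M G eps N n.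
        \<bar>(\<integral>x. additive_mean f n x \<partial>FK_path_approx E G H N n \<xi>)
          - (\<integral>x. additive_mean f n x \<partial>FK_path E \<eta>0 M G n)\<bar> \<ge> b / sqrt (real N) + \<epsilon>))
    \<le> ereal (- (\<epsilon>\<^sup>2 / (2 * b\<^sup>2)))"
proof -
  interpret feynman_kac_model E \<eta>0 M G H lam by (rule model)
  have E: "space E \<noteq> {}"
    using prob_space.not_empty[OF initial(1)] sets_eq_imp_space_eq[OF initial(2)] by simp
  \<comment> \<open>The infimum may equal 1; the cap 1 / 2 makes \<open>h\<close>, and with it
    \<theta>, strictly less than 1.\<close>
  define h where "h = min (INF (x, y, y') \<in> space E \<times> space E \<times> space E. H x y / H x y') (1 / 2)"
  have h: "0 < h" "h < 1" using H_ratio by (auto simp: h_def)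
  have H: "h * H x y' \<le> H x y" if "x \<in> space E" "y \<in> space E" "y' \<in> space E" for x y y'
  proof -
    have "bdd_below ((\<lambda>(x, y, y'). H x y / H x y') ` (space E \<times> space E \<times> space E))"
      using density_pos by (intro bdd_belowI2[of _ 0]) (auto simp: less_imp_le)
    from cINF_lower[OF this, of "(x, y, y')"] that have "h \<le> H x y / H x y'" by (simp add: h_def min.coboundedI1)
    then show ?thesis using density_pos[OF that(1,3)] by (simp add: pos_le_divide_eq)
  qed
  \<comment> \<open>The square is the price of comparability in the source; in the target
    \<open>h\<close> would do, and \<open>\<theta> \<le> h\<close>.\<close>
  define \<theta> where "\<theta> = h\<^sup>2"
  have "\<theta> \<le> h" using h mult_left_mono[of h 1 h] by (simp add: \<theta>_def power2_eq_square)
  then have \<theta>: "0 < \<theta>" "\<theta> < 1" "\<theta> \<le> h" using h by (auto simp: \<theta>_def)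
  have mixing: "mixing_model E \<eta>0 lam M G H eps N \<theta> \<delta>" if "1 \<le> N" for N
  proof unfold_locales
    show "\<theta> * H x y' \<le> H x y" if "x \<in> space E" "y \<in> space E" "y' \<in> space E" for x y y'
      using H[OF that] mult_right_mono[OF \<theta>(3), of "H x y'"] density_pos[OF that(1,3)] by linarith
    show "\<theta> * H x' y \<le> H x y" if "x \<in> space E" "x' \<in> space E" "y \<in> space E" for x x' y
      unfolding \<theta>_def using density_source_comparable[OF h(1) H that] by blast
  qed (use \<theta> eps params G_mixing that in auto)
  \<comment> \<open>\<open>C\<close> depends on \<theta> and \<delta> only, so \<open>B\<close> can
    be fixed before \<open>N\<close>.\<close>
  define B where "B = mixing_model.C \<theta> \<delta>"
  have B: "0 < B" unfolding B_def by (rule mixing_model.C_pos[OF mixing[OF order_refl]])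
  show ?thesis
  proof (intro exI[of _ "2 * B"] conjI allI impI)
    show "0 < 2 * B" using B by simp
    fix \<epsilon> :: real and N :: nat assume \<epsilon>: "0 < \<epsilon>" and N: "1 \<le> N"
    interpret mixing_model E \<eta>0 lam M G H eps N \<theta> \<delta> by (rule mixing[OF N])
    let ?t = "2 * B / sqrt (real N) + \<epsilon>"
    have "\<P>(\<xi> in particle_law E \<eta>0 M G eps N n.
        \<bar>(\<integral>x. additive_mean f n x \<partial>FK_path_approx E G H N n \<xi>)
          - (\<integral>x. additive_mean f n x \<partial>FK_path E \<eta>0 M G n)\<bar> \<ge> ?t) \<le> exp (- (N * \<epsilon>\<^sup>2 / (2 * (2 * B)\<^sup>2)))"
      (is "?P n \<le> _") for n
    proof -
      have "prob_space (particle_law E \<eta>0 M G eps N n)"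
        unfolding particle_law_def using prob_algebraD(1)[OF particle.path_prob] .
      moreover have "subgaussian (particle_law E \<eta>0 M G eps N n)
          (\<lambda>\<xi>. (\<integral>w. additive_mean f n w \<partial>FK_path_approx E G H N n \<xi>) - (\<integral>w. additive_mean f n w \<partial>FK_path E \<eta>0 M G n))
          (B / sqrt N)"
        unfolding B_def by (intro subgaussian_additive_error Osc1_bounded_band f E)
      ultimately have "?P n \<le> 2 * exp (- (?t\<^sup>2 / (2 * (B / sqrt N)\<^sup>2)))"
        using B N \<epsilon> by (intro subgaussian_tail) auto
      also have "2 * exp (- (?t\<^sup>2 / (2 * (B / sqrt N)\<^sup>2))) \<le> exp 1 * exp (- (2 + N * \<epsilon>\<^sup>2 / (2 * B\<^sup>2)))"
      proof (intro mult_mono)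
        \<comment> \<open>The cross term is dropped. The shift of twice the scale
          \<open>B / sqrt N\<close> contributes exactly 2 to the exponent, and this beats the
          prefactor because 2 \<le> exp 1.\<close>
        have "(2 * B / sqrt N)\<^sup>2 + \<epsilon>\<^sup>2 \<le> ?t\<^sup>2"
          using B \<epsilon> by (simp add: power2_sum)
        then have "((2 * B / sqrt N)\<^sup>2 + \<epsilon>\<^sup>2) / (2 * (B / sqrt N)\<^sup>2) \<le> ?t\<^sup>2 / (2 * (B / sqrt N)\<^sup>2)"
          by (intro divide_right_mono) auto
        moreover have "((2 * B / sqrt N)\<^sup>2 + \<epsilon>\<^sup>2) / (2 * (B / sqrt N)\<^sup>2) = 2 + N * \<epsilon>\<^sup>2 / (2 * B\<^sup>2)"
          using B N by (simp add: power_divide power_mult_distrib field_simps)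
        ultimately show "exp (- (?t\<^sup>2 / (2 * (B / sqrt N)\<^sup>2))) \<le> exp (- (2 + N * \<epsilon>\<^sup>2 / (2 * B\<^sup>2)))" by simp
        show "(2::real) \<le> exp 1" using exp_ge_add_one_self[of "1::real"] by simp
      qed auto
      also have "\<dots> = exp (- 1 - N * \<epsilon>\<^sup>2 / (2 * B\<^sup>2))" by (simp add: mult_exp_exp)
      also have "\<dots> \<le> exp (- (N * \<epsilon>\<^sup>2 / (2 * (2 * B)\<^sup>2)))"
      proof -
        \<comment> \<open>Passing from \<open>B\<close> to the witness \<open>2 * B\<close> in the
          exponent only weakens the bound.\<close>
        have "N * \<epsilon>\<^sup>2 / (2 * (2 * B)\<^sup>2) \<le> N * \<epsilon>\<^sup>2 / (2 * B\<^sup>2)"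
          using B by (intro divide_left_mono) (auto simp: power_mult_distrib)
        then show ?thesis by simp
      qed
      finally show ?thesis .
    qed
    then have "(SUP n. ?P n) \<le> exp (- (N * \<epsilon>\<^sup>2 / (2 * (2 * B)\<^sup>2)))" by (intro cSUP_least) auto
    from eln_le[OF this, of "1 / real N"] N
    show "ereal (1 / real N) * eln (SUP n. ?P n) \<le> ereal (- (\<epsilon>\<^sup>2 / (2 * (2 * B)\<^sup>2)))" by simp
  qed
qed

end
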